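(* There exists $N$ such that for all $n \ge N$, $\mathrm{SPEX}(n, W_5) \subseteq \mathrm{EX}(n, W_5)$.
   Context: $W_t$ denotes the wheel on $t$ vertices: a vertex joined to every vertex of a cycle on $t-1$ vertices (so $W_5$ is a vertex joined to a $4$-cycle). For a graph $F$, $\mathrm{EX}(n,F)$ is the family of $n$-vertex graphs not containing $F$ as a subgraph having the maximum possible number of edges, $\mathrm{ex}(n,F)$. $\lambda_1(G)$ is the largest eigenvalue of the adjacency matrix of $G$, and $\mathrm{SPEX}(n,F)$ is the family of $n$-vertex $F$-free graphs $G$ whose $\lambda_1(G)$ equals the maximum of $\lambda_1$ over all $n$-vertex $F$-free graphs. *)

theory Defs
  imports "Jordan_Normal_Form.Spectral_Radius"
begin

text \<open>A graph is a pair of a vertex set and a set of edges, each edge being a two-element set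
  of vertices.\<close>

type_synonym 'a ugraph = "'a set \<times> 'a set set"

abbreviation vertices :: "'a ugraph \<Rightarrow> 'a set" where
  "vertices G \<equiv> fst G"

abbreviation edges :: "'a ugraph \<Rightarrow> 'a set set" where
  "edges G \<equiv> snd G"

definition simple_graph :: "'a ugraph \<Rightarrow> bool" where
  "simple_graph G \<longleftrightarrow> finite (vertices G) \<and> (\<forall>e\<in>edges G. e \<subseteq> vertices G \<and> card e = 2)"

text \<open>Subgraph containment is up to isomorphism and need not be induced.\<close>

definition contains_subgraph :: "'a ugraph \<Rightarrow> 'b ugraph \<Rightarrow> bool" where
  "contains_subgraph G F \<longleftrightarrow>
     (\<exists>f. inj_on f (vertices F) \<and> f ` vertices F \<subseteq> vertices G \<and> (\<forall>e\<in>edges F. f ` e \<in> edges G))"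

text \<open>The hub of the wheel on \<open>t\<close> vertices is \<open>0\<close>, its rim is the cycle \<open>1, \<dots>, t - 1\<close>;
  only \<open>t \<ge> 4\<close> is meaningful.\<close>

definition wheel :: "nat \<Rightarrow> nat ugraph" where
  "wheel t = ({..<t},
     {{0, i} | i. 1 \<le> i \<and> i < t} \<union> {{i, i + 1} | i. 1 \<le> i \<and> i + 1 < t} \<union> {{t - 1, 1}})"

text \<open>The \<open>n\<close>-vertex graphs are represented by the labelled graphs with vertex set
  \<open>{..<n}\<close>, which meet every isomorphism class.\<close>

definition free_graphs :: "nat \<Rightarrow> 'b ugraph \<Rightarrow> nat ugraph set" where
  "free_graphs n F =
     {G. simple_graph G \<and> vertices G = {..<n} \<and> \<not> contains_subgraph G F}"

text \<open>Rows and columns are indexed by the vertices themselves, so this is the adjacency matrix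
  only if the vertex set is an initial segment of the natural numbers.\<close>

definition adjacency_matrix :: "nat ugraph \<Rightarrow> real mat" where
  "adjacency_matrix G =
     mat (card (vertices G)) (card (vertices G)) (\<lambda>(i, j). if {i, j} \<in> edges G then 1 else 0)"

text \<open>The spectrum of a real matrix here consists of its real eigenvalues; adjacency matrices
  are symmetric and have no others.\<close>

definition lambda1 :: "nat ugraph \<Rightarrow> real" where
  "lambda1 G = Max (spectrum (adjacency_matrix G))"

definition ex_number :: "nat \<Rightarrow> 'b ugraph \<Rightarrow> nat" where
  "ex_number n F = Max ((\<lambda>G. card (edges G)) ` free_graphs n F)"

definition EX_family :: "nat \<Rightarrow> 'b ugraph \<Rightarrow> nat ugraph set" where
  "EX_family n F = {G \<in> free_graphs n F. card (edges G) = ex_number n F}"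

definition SPEX_family :: "nat \<Rightarrow> 'b ugraph \<Rightarrow> nat ugraph set" where
  "SPEX_family n F = {G \<in> free_graphs n F. lambda1 G = Max (lambda1 ` free_graphs n F)}"

text \<open>The maxima in \<^const>\<open>ex_number\<close> and \<^const>\<open>SPEX_family\<close> are over finite sets, nonempty for wheels.\<close>

lemma finite_free_graphs: "finite (free_graphs n F)"
proof (rule finite_subset)
  show "free_graphs n F \<subseteq> {{..<n}} \<times> Pow (Pow {..<n})"
    by (fastforce simp: free_graphs_def simple_graph_def)
qed simp

lemma empty_graph_in_free_graphs:
  assumes "edges F \<noteq> {}"
  shows "({..<n}, {}) \<in> free_graphs n F"
  using assms by (auto simp: free_graphs_def simple_graph_def contains_subgraph_def)

lemma edges_wheel_nonempty: "edges (wheel t) \<noteq> {}"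
  by (simp add: wheel_def)

lemma wheel_5:
  "wheel 5 = ({0, 1, 2, 3, 4},
     {{0, 1}, {0, 2}, {0, 3}, {0, 4}, {1, 2}, {2, 3}, {3, 4}, {4, 1}})"
proof -
  have *: "1 \<le> i \<and> i < 5 \<longleftrightarrow> i = 1 \<or> i = 2 \<or> i = 3 \<or> i = 4"
       "1 \<le> i \<and> i + 1 < 5 \<longleftrightarrow> i = 1 \<or> i = 2 \<or> i = 3" for i :: nat
    by auto
  have v: "{..<5::nat} = {0, 1, 2, 3, 4}"
    by auto
  have spokes: "{{0, i} | i::nat. 1 \<le> i \<and> i < 5} = {{0, 1}, {0, 2}, {0, 3}, {0, 4}}"
    unfolding * by blast
  have rim: "{{i, i + 1} | i::nat. 1 \<le> i \<and> i + 1 < 5} = {{1, 2}, {2, 3}, {3, 4}}"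
    unfolding * by (auto simp: numeral_2_eq_2)
  show ?thesis
    unfolding wheel_def v spokes rim by (simp add: insert_commute)
qed

lemma simple_graph_wheel_5: "simple_graph (wheel 5)"
  by (simp add: simple_graph_def wheel_5)

end

theory Submission
  imports Defs "HOL-Analysis.Function_Topology"
begin

text \<open>Let \<open>G\<close> be a \<open>W\<^sub>5\<close>-free graph on \<open>n\<close> vertices with \<open>\<mu> = \<lambda>\<^sub>1(G) \<ge> n/2 + 1 - 2/n\<close> and Perron vector \<open>x\<close>,
  scaled to maximal entry \<open>x z = 1\<close>. Expanding \<open>\<mu>\<^sup>2 x z\<close> counts walks of length two from \<open>z\<close>; since
  the neighbourhood of \<open>z\<close> is \<open>C\<^sub>4\<close>-free, almost all of them cross the cut between the neighbourhood
  and its complement, so a maximum cut of \<open>G\<close> misses only a tiny fraction of \<open>n\<^sup>2/4\<close> pairs.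
  Testing the eigenvalue equation against the Perron vector of the complete bipartite graph on this
  cut shows that a vertex with many missing neighbours would cost more than the edges inside
  the parts can gain. Hence there is no such vertex, and then \<open>W\<^sub>5\<close>-freeness forces the edges
  inside the parts to form a matching.

  Consequently \<open>\<mu> \<le> 1 + sqrt (a b)\<close> and \<open>G\<close> has at most \<open>a b + a div 2 + b div 2\<close> edges, where \<open>a\<close> and \<open>b\<close>
  are the sizes of the parts; a spectrally extremal \<open>G\<close> attains this number, because any
  edge that could be added would increase \<open>\<mu>\<close>. Comparison with one explicit graph, together with
  a parity argument, determines \<open>a b\<close> well enough to make the number of edges maximal.
  A graph with at least the extremal number of edges has large average degree, so it is
  covered by the same structure result.\<close>

section \<open>Rayleigh quotients and the Perron eigenvector\<close>

definition quad_form :: "'a set \<Rightarrow> ('a \<Rightarrow> 'a \<Rightarrow> real) \<Rightarrow> ('a \<Rightarrow> real) \<Rightarrow> real" where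
  "quad_form V a x = (\<Sum>u\<in>V. \<Sum>v\<in>V. a u v * x u * x v)"

definition sq_norm :: "'a set \<Rightarrow> ('a \<Rightarrow> real) \<Rightarrow> real" where
  "sq_norm V x = (\<Sum>v\<in>V. (x v)\<^sup>2)"

lemma quad_form_eq: "quad_form V a x = (\<Sum>u\<in>V. x u * (\<Sum>v\<in>V. a u v * x v))"
  by (simp add: quad_form_def sum_distrib_left mult_ac)

lemma sq_norm_nonneg: "0 \<le> sq_norm V x"
  by (simp add: sq_norm_def sum_nonneg)

lemma sq_norm_eq_0_iff: "finite V \<Longrightarrow> sq_norm V x = 0 \<longleftrightarrow> (\<forall>v\<in>V. x v = 0)"
  by (simp add: sq_norm_def sum_nonneg_eq_0_iff)

lemma quad_form_eigenvector:
  assumes "\<And>u. u \<in> V \<Longrightarrow> (\<Sum>v\<in>V. a u v * x v) = \<mu> * x u"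
  shows "quad_form V a x = \<mu> * sq_norm V x"
proof -
  have "quad_form V a x = (\<Sum>u\<in>V. \<mu> * (x u)\<^sup>2)"
    unfolding quad_form_eq by (rule sum.cong) (simp_all add: assms power2_eq_square)
  then show ?thesis
    by (simp add: sq_norm_def sum_distrib_left)
qed

lemma nonpos_of_linear_le_quadratic:
  fixes s C :: real
  assumes "\<And>t. t * s \<le> t\<^sup>2 * C"
  shows "s \<le> 0"
proof (rule ccontr)
  assume "\<not> s \<le> 0"
  \<comment> \<open>Small enough that \<open>t * C\<close> is at most \<open>s / 2\<close>, hence
    below \<open>s\<close>.\<close>
  define t where "t = s / (\<bar>C\<bar> + 1) / 2"
  have t: "t > 0" "t * (\<bar>C\<bar> + 1) = s / 2"
    using \<open>\<not> s \<le> 0\<close> by (auto simp: t_def field_simps)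
  have "t * s \<le> t * (t * C)"
    using assms[of t] by (simp add: power2_eq_square mult_ac)
  then have "s \<le> t * C"
    using t by simp
  also have "\<dots> \<le> t * (\<bar>C\<bar> + 1)"
    using t by (intro mult_left_mono) auto
  finally show False
    using t \<open>\<not> s \<le> 0\<close> by simp
qed

text \<open>First variation of the Rayleigh quotient in the direction of the residual \<open>A x - \<mu> x\<close>.\<close>

lemma rayleigh_maximizer_eigenvector:
  fixes a :: "'a \<Rightarrow> 'a \<Rightarrow> real"
  assumes fin: "finite V"
    and sym: "\<And>u v. a u v = a v u"
    and le: "\<And>y. quad_form V a y \<le> \<mu> * sq_norm V y"
    and eq: "quad_form V a x = \<mu> * sq_norm V x"
    and u: "u \<in> V"
  shows "(\<Sum>v\<in>V. a u v * x v) = \<mu> * x u"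
proof -
  define h where "h u = (\<Sum>v\<in>V. a u v * x v) - \<mu> * x u" for u
  have "2 * sq_norm V h \<le> 0"
  proof (rule nonpos_of_linear_le_quadratic)
    fix t :: real
    have swap: "(\<Sum>u\<in>V. \<Sum>v\<in>V. a u v * x u * h v) = (\<Sum>u\<in>V. \<Sum>v\<in>V. a u v * h u * x v)"
      by (subst sum.swap) (auto intro!: sum.cong simp: sym mult_ac)
    have q: "quad_form V a (\<lambda>v. x v + t * h v) = quad_form V a x
        + 2 * t * (\<Sum>u\<in>V. \<Sum>v\<in>V. a u v * h u * x v) + t\<^sup>2 * quad_form V a h"
    proof -
      have "quad_form V a (\<lambda>v. x v + t * h v) = quad_form V a x
          + t * (\<Sum>u\<in>V. \<Sum>v\<in>V. a u v * x u * h v) + t * (\<Sum>u\<in>V. \<Sum>v\<in>V. a u v * h u * x v)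
          + t\<^sup>2 * quad_form V a h"
        unfolding quad_form_def sum_distrib_left sum.distrib [symmetric]
        by (intro sum.cong) (auto simp: algebra_simps power2_eq_square)
      then show ?thesis
        unfolding swap by simp
    qed
    have s: "sq_norm V (\<lambda>v. x v + t * h v) = sq_norm V x + 2 * t * (\<Sum>v\<in>V. h v * x v)
        + t\<^sup>2 * sq_norm V h"
      unfolding sq_norm_def
      by (simp add: power2_eq_square algebra_simps sum.distrib sum_distrib_left)
    \<comment> \<open>Half the directional derivative. Taking the residual itself as direction turns
      it into a sum of squares, which is thereby forced to vanish.\<close>
    have hh: "(\<Sum>u\<in>V. \<Sum>v\<in>V. a u v * h u * x v) - \<mu> * (\<Sum>v\<in>V. h v * x v) = sq_norm V h"
      unfolding sq_norm_def h_def [abs_def]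
      by (simp add: power2_eq_square algebra_simps sum.distrib sum_distrib_left sum_subtractf)
    have "2 * t * ((\<Sum>u\<in>V. \<Sum>v\<in>V. a u v * h u * x v) - \<mu> * (\<Sum>v\<in>V. h v * x v))
        \<le> t\<^sup>2 * (\<mu> * sq_norm V h - quad_form V a h)"
      using le[of "\<lambda>v. x v + t * h v"] unfolding q s eq by (simp add: algebra_simps)
    then show "t * (2 * sq_norm V h) \<le> t\<^sup>2 * (\<mu> * sq_norm V h - quad_form V a h)"
      unfolding hh by (simp add: mult_ac)
  qed
  then have "sq_norm V h = 0"
    using sq_norm_nonneg[of V h] by linarith
  then show ?thesis
    using u by (simp add: sq_norm_eq_0_iff fin h_def)
qed

text \<open>Fixing the coordinates outside \<open>V\<close> to 0 makes the set a closed part of a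
  product of compact intervals, so Tychonoff applies even to an infinite vertex type.\<close>

lemma compact_nonneg_unit_sphere:
  assumes "finite V"
  shows "compact {x :: 'a \<Rightarrow> real. (\<forall>v\<in>V. 0 \<le> x v) \<and> (\<forall>v. v \<notin> V \<longrightarrow> x v = 0) \<and> sq_norm V x = 1}"
    (is "compact ?K")
proof -
  define P :: "('a \<Rightarrow> real) set" where "P = PiE UNIV (\<lambda>v. if v \<in> V then {0..1} else {0})"
  have "compactin (product_topology (\<lambda>_. euclidean) UNIV) P"
    unfolding P_def by (subst compactin_PiE) auto
  then have "compact P"
    by (simp add: euclidean_product_topology)
  moreover have "closed {x :: 'a \<Rightarrow> real. sq_norm V x = 1}"
    unfolding sq_norm_def by (intro closed_Collect_eq continuous_intros continuous_on_product_coordinates)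
  ultimately have "compact (P \<inter> {x. sq_norm V x = 1})"
    by (rule compact_Int_closed)
  moreover have "P \<inter> {x. sq_norm V x = 1} = ?K"
  proof -
    have "x v \<le> 1" if "sq_norm V x = 1" "v \<in> V" for x v
    proof -
      have "(x v)\<^sup>2 \<le> 1"
        using member_le_sum[of v V "\<lambda>v. (x v)\<^sup>2"] that assms by (simp add: sq_norm_def)
      then show ?thesis
        by (simp add: abs_square_le_1)
    qed
    then show ?thesis
      by (fastforce simp: P_def PiE_def Pi_def split: if_splits)
  qed
  ultimately show ?thesis
    by simp
qed

text \<open>Maximise the quadratic form on the nonnegative unit sphere. Since \<open>a\<close> is
  nonnegative, passing to absolute values never decreases the form, so the maximum bounds it for
  vectors of any sign and the first variation applies. Without irreducibility only some entry is
  known to be positive.\<close>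

lemma perron_eigenvector_exists:
  fixes a :: "'a \<Rightarrow> 'a \<Rightarrow> real"
  assumes fin: "finite V" and ne: "V \<noteq> {}"
    and sym: "\<And>u v. a u v = a v u" and nonneg: "\<And>u v. 0 \<le> a u v"
  obtains \<mu> x where
    "\<And>v. v \<in> V \<Longrightarrow> 0 \<le> x v" "\<exists>v\<in>V. 0 < x v"
    "\<And>u. u \<in> V \<Longrightarrow> (\<Sum>v\<in>V. a u v * x v) = \<mu> * x u"
    "\<And>y. quad_form V a y \<le> \<mu> * sq_norm V y"
proof -
  define K where "K = {x :: 'a \<Rightarrow> real. (\<forall>v\<in>V. 0 \<le> x v) \<and> (\<forall>v. v \<notin> V \<longrightarrow> x v = 0) \<and> sq_norm V x = 1}"
  obtain w where w: "w \<in> V"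
    using ne by blast
  have "(\<lambda>v. of_bool (v = w)) \<in> K"
    using w fin by (auto simp: K_def sq_norm_def power2_eq_square of_bool_def
        if_distrib[of "\<lambda>z. z * _"] cong: if_cong)
  then have "K \<noteq> {}"
    by blast
  moreover have "compact K"
    unfolding K_def by (rule compact_nonneg_unit_sphere [OF fin])
  moreover have "continuous_on K (quad_form V a)"
    unfolding quad_form_def
    by (intro continuous_intros continuous_on_subset [OF continuous_on_product_coordinates]) auto
  ultimately obtain x where x: "x \<in> K" "\<And>y. y \<in> K \<Longrightarrow> quad_form V a y \<le> quad_form V a x"
    using continuous_attains_sup [of K "quad_form V a"] by blast
  define \<mu> where "\<mu> = quad_form V a x"
  have le: "quad_form V a y \<le> \<mu> * sq_norm V y" for y
  proof (cases "sq_norm V y = 0")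
    case True
    then show ?thesis
      using fin sq_norm_eq_0_iff [OF fin, of y] by (simp add: quad_form_def)
  next
    case False
    define s where "s = sqrt (sq_norm V y)"
    have s: "s > 0" "s\<^sup>2 = sq_norm V y"
      using False sq_norm_nonneg [of V y] by (auto simp: s_def)
    define y' where "y' v = (if v \<in> V then \<bar>y v\<bar> / s else 0)" for v
    have "sq_norm V y' = 1"
      using s False by (simp add: sq_norm_def y'_def power_divide sum_divide_distrib [symmetric])
    then have "y' \<in> K"
      using s by (auto simp: K_def y'_def)
    then have "quad_form V a y' \<le> \<mu>"
      using x by (simp add: \<mu>_def)
    moreover have "quad_form V a y' = quad_form V a (\<lambda>v. \<bar>y v\<bar>) / s\<^sup>2"
      by (simp add: quad_form_def y'_def sum_divide_distrib power2_eq_square)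
    moreover have "quad_form V a y \<le> quad_form V a (\<lambda>v. \<bar>y v\<bar>)"
      unfolding quad_form_def
    proof (intro sum_mono)
      fix u v
      show "a u v * y u * y v \<le> a u v * \<bar>y u\<bar> * \<bar>y v\<bar>"
        using mult_left_mono [OF abs_ge_self [of "y u * y v"] nonneg [of u v]]
        by (simp add: abs_mult mult.assoc)
    qed
    moreover have "0 < s\<^sup>2"
      using s(1) by simp
    ultimately show ?thesis
      unfolding s(2) [symmetric] by (simp add: divide_le_eq)
  qed
  have xK: "sq_norm V x = 1" "\<And>v. v \<in> V \<Longrightarrow> 0 \<le> x v"
    using x by (auto simp: K_def)
  have ev: "(\<Sum>v\<in>V. a u v * x v) = \<mu> * x u" if "u \<in> V" for u
    using fin sym le _ that
    by (rule rayleigh_maximizer_eigenvector) (simp add: xK \<mu>_def)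
  have "\<exists>v\<in>V. x v \<noteq> 0"
    using xK sq_norm_eq_0_iff [OF fin, of x] by auto
  then have "\<exists>v\<in>V. 0 < x v"
    using xK by force
  with xK ev le that show thesis
    by blast
qed

section \<open>Adjacency matrices and their largest eigenvalue\<close>

definition adj_ind :: "'a ugraph \<Rightarrow> 'a \<Rightarrow> 'a \<Rightarrow> real" where
  "adj_ind G u v = (if {u, v} \<in> edges G then 1 else 0)"

lemma eigenvalue_adjacency_matrix_iff:
  assumes "vertices G = {..<n}"
  shows "eigenvalue (adjacency_matrix G) k \<longleftrightarrow>
    (\<exists>x. (\<exists>v<n. x v \<noteq> 0) \<and> (\<forall>u<n. (\<Sum>v<n. adj_ind G u v * x v) = k * x u))"
proof -
  have dim: "dim_row (adjacency_matrix G) = n"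
    by (simp add: adjacency_matrix_def assms)
  show ?thesis
  proof
    assume "eigenvalue (adjacency_matrix G) k"
    then obtain w where w: "w \<in> carrier_vec n" "w \<noteq> 0\<^sub>v n" "adjacency_matrix G *\<^sub>v w = k \<cdot>\<^sub>v w"
      using dim unfolding eigenvalue_def eigenvector_def by auto
    then have dim_w: "dim_vec w = n"
      by simp
    have "\<exists>v<n. w $ v \<noteq> 0"
    proof (rule ccontr)
      assume "\<not> ?thesis"
      then have "w = 0\<^sub>v n"
        by (intro eq_vecI) (auto simp: dim_w)
      with w(2) show False
        by simp
    qed
    moreover have "(\<Sum>v<n. adj_ind G u v * (w $ v)) = k * (w $ u)" if "u < n" for u
    proof -
      have "(adjacency_matrix G *\<^sub>v w) $ u = (\<Sum>v<n. adj_ind G u v * (w $ v))"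
        using that dim_w assms
        by (auto simp: adjacency_matrix_def scalar_prod_def adj_ind_def lessThan_atLeast0 intro!: sum.cong)
      then show ?thesis
        using w dim_w that by simp
    qed
    ultimately show "\<exists>x. (\<exists>v<n. x v \<noteq> 0) \<and> (\<forall>u<n. (\<Sum>v<n. adj_ind G u v * x v) = k * x u)"
      by (intro exI [of _ "\<lambda>v. w $ v"]) blast
  next
    assume "\<exists>x. (\<exists>v<n. x v \<noteq> 0) \<and> (\<forall>u<n. (\<Sum>v<n. adj_ind G u v * x v) = k * x u)"
    then obtain x where x: "\<exists>v<n. x v \<noteq> 0" "\<And>u. u < n \<Longrightarrow> (\<Sum>v<n. adj_ind G u v * x v) = k * x u"
      by blast
    have "adjacency_matrix G *\<^sub>v vec n x = k \<cdot>\<^sub>v vec n x"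
    proof (rule eq_vecI)
      fix u assume "u < dim_vec (k \<cdot>\<^sub>v vec n x)"
      then have "u < n"
        by simp
      then have "(adjacency_matrix G *\<^sub>v vec n x) $ u = (\<Sum>v<n. adj_ind G u v * x v)"
        using assms
        by (auto simp: adjacency_matrix_def scalar_prod_def adj_ind_def lessThan_atLeast0 intro!: sum.cong)
      then show "(adjacency_matrix G *\<^sub>v vec n x) $ u = (k \<cdot>\<^sub>v vec n x) $ u"
        using x(2) \<open>u < n\<close> by simp
    qed (simp add: adjacency_matrix_def assms)
    moreover have "vec n x \<noteq> 0\<^sub>v n"
    proof
      assume "vec n x = 0\<^sub>v n"
      then have "vec n x $ v = 0" if "v < n" for v
        using that by simp
      with x(1) show False
        by auto
    qed
    ultimately show "eigenvalue (adjacency_matrix G) k"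
      unfolding eigenvalue_def eigenvector_def dim
      by (intro exI [of _ "vec n x"]) simp
  qed
qed

text \<open>Each eigenvalue is the Rayleigh quotient of its eigenvector, so the Rayleigh maximum is
  the largest one.\<close>

lemma lambda1_perron:
  assumes V: "vertices G = {..<n}" and "0 < n"
  obtains x where
    "\<And>v. v < n \<Longrightarrow> 0 \<le> x v" "\<exists>v<n. 0 < x v"
    "\<And>u. u < n \<Longrightarrow> (\<Sum>v<n. adj_ind G u v * x v) = lambda1 G * x u"
    "\<And>y. quad_form {..<n} (adj_ind G) y \<le> lambda1 G * sq_norm {..<n} y"
proof -
  obtain \<mu> x where x: "\<And>v. v \<in> {..<n} \<Longrightarrow> 0 \<le> x v" "\<exists>v\<in>{..<n}. 0 < x v"
    "\<And>u. u \<in> {..<n} \<Longrightarrow> (\<Sum>v<n. adj_ind G u v * x v) = \<mu> * x u"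
    "\<And>y. quad_form {..<n} (adj_ind G) y \<le> \<mu> * sq_norm {..<n} y"
    by (rule perron_eigenvector_exists [of "{..<n}" "adj_ind G"])
      (use \<open>0 < n\<close> in \<open>auto simp: adj_ind_def insert_commute\<close>)
  have "lambda1 G = \<mu>"
    unfolding lambda1_def spectrum_def
  proof (rule Max_eqI)
    have "finite (spectrum (adjacency_matrix G))"
      by (rule card_finite_spectrum [of _ n]) (simp add: adjacency_matrix_def V)
    then show "finite (Collect (eigenvalue (adjacency_matrix G)))"
      by (simp add: spectrum_def)
    show "\<mu> \<in> Collect (eigenvalue (adjacency_matrix G))"
      unfolding mem_Collect_eq eigenvalue_adjacency_matrix_iff [OF V]
      using x(2,3) by (intro exI [of _ x]) force
    fix k assume "k \<in> Collect (eigenvalue (adjacency_matrix G))"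
    then obtain y where y: "\<exists>v<n. y v \<noteq> 0" "\<And>u. u \<in> {..<n} \<Longrightarrow> (\<Sum>v<n. adj_ind G u v * y v) = k * y u"
      unfolding mem_Collect_eq eigenvalue_adjacency_matrix_iff [OF V] by auto
    have "k * sq_norm {..<n} y \<le> \<mu> * sq_norm {..<n} y"
      using quad_form_eigenvector [OF y(2)] x(4) [of y] by simp
    moreover have "sq_norm {..<n} y > 0"
      using y(1) sq_norm_nonneg [of "{..<n}" y] sq_norm_eq_0_iff [of "{..<n}" y] by (auto simp: less_le)
    ultimately show "k \<le> \<mu>"
      by simp
  qed
  show thesis
    by (rule that [of x]) (use x \<open>lambda1 G = \<mu>\<close> in auto)
qed

section \<open>Graphs without a wheel on five vertices\<close>

text \<open>Degree bounds are stated as real sums; this recovers two distinct witnesses when the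
  bound 1 fails.\<close>

lemma sum_indicator_gt_1:
  assumes "finite X" and "\<And>v. f v = (if P v then 1 else 0 :: real)" and "1 < (\<Sum>v\<in>X. f v)"
  obtains v w where "v \<in> X" "w \<in> X" "v \<noteq> w" "P v" "P w"
proof -
  have "(\<Sum>v\<in>X. f v) = card {v \<in> X. P v}"
    using assms(1,2) by (simp add: sum.If_cases Int_def)
  then have "\<not> card {v \<in> X. P v} \<le> Suc 0"
    using assms(3) by auto
  then have "\<exists>v\<in>{v \<in> X. P v}. \<exists>w\<in>{v \<in> X. P v}. v \<noteq> w"
    using assms(1) by (subst (asm) card_le_Suc0_iff_eq) auto
  with that show thesis
    by blast
qed

locale simple_ugraph =
  fixes G :: "'a ugraph"
  assumes simple: "simple_graph G"
begin

abbreviation V :: "'a set" where "V \<equiv> vertices G"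
abbreviation adj :: "'a \<Rightarrow> 'a \<Rightarrow> bool" where "adj u v \<equiv> {u, v} \<in> edges G"
abbreviation E :: "'a \<Rightarrow> 'a \<Rightarrow> real" where "E \<equiv> adj_ind G"

lemma finite_V: "finite V"
  using simple by (simp add: simple_graph_def)

lemma adj_sym: "adj u v \<longleftrightarrow> adj v u"
  by (simp add: insert_commute)

lemma not_adj_self: "\<not> adj u u"
  using simple by (force simp: simple_graph_def)

lemma adj_in_V: "adj u v \<Longrightarrow> u \<in> V \<and> v \<in> V"
  using simple by (force simp: simple_graph_def)

lemma E_sym: "E u v = E v u"
  by (simp add: adj_ind_def insert_commute)

lemma E_self: "E u u = 0"
  using not_adj_self [of u] by (simp add: adj_ind_def)

lemma E_bounds: "0 \<le> E u v" "E u v \<le> 1"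
  by (simp_all add: adj_ind_def)

text \<open>Count paths of length two and bound \<open>d \<le> (d\<^sup>2 - d) / k + (k + 1)\<close>. The true order is
  \<open>(card N) powr (3 / 2)\<close>, but a small multiple of \<open>(card N)\<^sup>2\<close> is enough below.\<close>

lemma sum_degrees_C4_free_le:
  fixes k :: real
  assumes fin: "finite N" and k: "k \<ge> 1"
    and codeg: "\<And>u v. u \<in> N \<Longrightarrow> v \<in> N \<Longrightarrow> u \<noteq> v \<Longrightarrow> (\<Sum>w\<in>N. E u w * E v w) \<le> 1"
  shows "(\<Sum>u\<in>N. \<Sum>v\<in>N. E u v) \<le> (card N)\<^sup>2 / k + (k + 1) * card N"
proof -
  define d where "d w = (\<Sum>v\<in>N. E w v)" for w
  have d_sym: "d w = (\<Sum>v\<in>N. E v w)" for w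
    unfolding d_def by (intro sum.cong refl E_sym)
  have "(\<Sum>w\<in>N. (d w)\<^sup>2) = (\<Sum>w\<in>N. \<Sum>u\<in>N. \<Sum>v\<in>N. E u w * E v w)"
    by (simp add: power2_eq_square d_sym sum_product)
  also have "\<dots> = (\<Sum>u\<in>N. \<Sum>w\<in>N. \<Sum>v\<in>N. E u w * E v w)"
    by (rule sum.swap)
  also have "\<dots> = (\<Sum>u\<in>N. \<Sum>v\<in>N. \<Sum>w\<in>N. E u w * E v w)"
    by (intro sum.cong refl sum.swap)
  also have "\<dots> \<le> (\<Sum>u\<in>N. \<Sum>v\<in>N. (if u = v then d u else 0) + 1)"
  proof (intro sum_mono)
    fix u v assume "u \<in> N" "v \<in> N"
    moreover have "(\<Sum>w\<in>N. E u w * E u w) = d u"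
      unfolding d_def by (intro sum.cong) (auto simp: adj_ind_def)
    ultimately show "(\<Sum>w\<in>N. E u w * E v w) \<le> (if u = v then d u else 0) + 1"
      using codeg [of u v] by auto
  qed
  also have "\<dots> = (\<Sum>u\<in>N. d u) + (card N)\<^sup>2"
    using fin by (simp add: sum.distrib power2_eq_square)
  finally have sq: "(\<Sum>w\<in>N. (d w)\<^sup>2) - (\<Sum>w\<in>N. d w) \<le> (card N)\<^sup>2"
    by simp
  have "d w \<le> ((d w)\<^sup>2 - d w) / k + (k + 1)" for w
  proof -
    \<comment> \<open>Completes the square in \<open>d^2 - (k + 1) d + k (k + 1)\<close>.\<close>
    have "0 \<le> (d w - (k + 1) / 2)\<^sup>2 + (k + 1) * (3 * k - 1) / 4"
      using k by simp
    then have "d w * k \<le> (d w)\<^sup>2 - d w + (k + 1) * k"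
      by (simp add: power2_eq_square field_simps)
    then show ?thesis
      using k by (simp add: field_simps)
  qed
  then have "(\<Sum>w\<in>N. d w) \<le> (\<Sum>w\<in>N. ((d w)\<^sup>2 - d w) / k + (k + 1))"
    by (intro sum_mono)
  also have "\<dots> = ((\<Sum>w\<in>N. (d w)\<^sup>2) - (\<Sum>w\<in>N. d w)) / k + (k + 1) * card N"
    by (simp add: sum.distrib sum_subtractf sum_divide_distrib [symmetric] diff_divide_distrib mult.commute)
  also have "\<dots> \<le> (card N)\<^sup>2 / k + (k + 1) * card N"
    using sq k by (simp add: divide_right_mono)
  finally show ?thesis
    by (simp add: d_def)
qed

end

text \<open>In a simple graph the adjacencies already make all other pairs among the five vertices distinct.\<close>

definition wheel5_free :: "'a ugraph \<Rightarrow> bool" where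
  "wheel5_free G \<longleftrightarrow> (\<forall>h a b c d. {h, a} \<in> edges G \<longrightarrow> {h, b} \<in> edges G \<longrightarrow> {h, c} \<in> edges G \<longrightarrow>
     {h, d} \<in> edges G \<longrightarrow> {a, b} \<in> edges G \<longrightarrow> {b, c} \<in> edges G \<longrightarrow> {c, d} \<in> edges G \<longrightarrow>
     {d, a} \<in> edges G \<longrightarrow> a = c \<or> b = d)"

lemma contains_wheel5_iff:
  assumes "simple_graph G"
  shows "contains_subgraph G (wheel 5) \<longleftrightarrow> \<not> wheel5_free G"
proof
  interpret simple_ugraph G
    by unfold_locales (fact assms)
  show "\<not> wheel5_free G" if contains: "contains_subgraph G (wheel 5)"
  proof -
    obtain f where f: "inj_on f (vertices (wheel 5))" "\<forall>e\<in>edges (wheel 5). f ` e \<in> edges G"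
      using contains unfolding contains_subgraph_def by blast
    then have e: "{f 0, f 1} \<in> edges G" "{f 0, f 2} \<in> edges G" "{f 0, f 3} \<in> edges G" "{f 0, f 4} \<in> edges G"
      "{f 1, f 2} \<in> edges G" "{f 2, f 3} \<in> edges G" "{f 3, f 4} \<in> edges G" "{f 4, f 1} \<in> edges G"
      unfolding wheel_5 by simp_all
    have "f 1 \<noteq> f 3" "f 2 \<noteq> f 4"
      using f(1) unfolding wheel_5 by (auto simp: inj_on_def)
    with e show ?thesis
      unfolding wheel5_free_def by blast
  qed
  show "contains_subgraph G (wheel 5)" if not_free: "\<not> wheel5_free G"
  proof -
    obtain h a b c d where e: "adj h a" "adj h b" "adj h c" "adj h d" "adj a b" "adj b c" "adj c d" "adj d a"
      and ne: "a \<noteq> c" "b \<noteq> d"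
      using not_free unfolding wheel5_free_def by blast
    have ne': "h \<noteq> a" "h \<noteq> b" "h \<noteq> c" "h \<noteq> d" "a \<noteq> b" "b \<noteq> c" "c \<noteq> d" "d \<noteq> a"
      using e not_adj_self by metis+
    define f where "f i = (if i = 0 then h else if i = 1 then a else if i = 2 then b else if i = 3 then c else d)"
      for i :: nat
    have f: "f 0 = h" "f 1 = a" "f (Suc 0) = a" "f 2 = b" "f 3 = c" "f 4 = d"
      by (simp_all add: f_def)
    have "inj_on f {0, 1, 2, 3, 4}"
      using ne ne' by (auto simp: inj_on_def f)
    moreover have "f ` {0, 1, 2, 3, 4} \<subseteq> V"
      using e adj_in_V by (auto simp: f)
    ultimately show ?thesis
      unfolding contains_subgraph_def wheel_5 using e by (intro exI [of _ f]) (auto simp: f)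
  qed
qed

locale wheel5_free_ugraph = simple_ugraph +
  assumes w5: "wheel5_free G"
begin

text \<open>Two such vertices \<open>p\<close>, \<open>q\<close> would give the rim
  \<open>u\<close>, \<open>p\<close>, \<open>v\<close>, \<open>q\<close> around the hub
  \<open>h\<close>.\<close>

lemma common_neighbours_le_1:
  assumes "finite X" "adj h u" "adj h v" "u \<noteq> v"
  shows "(\<Sum>w\<in>X. E h w * E u w * E v w) \<le> 1"
proof (rule ccontr)
  assume "\<not> ?thesis"
  then have *: "1 < (\<Sum>w\<in>X. E h w * E u w * E v w)"
    by simp
  have "E h w * E u w * E v w = (if adj h w \<and> adj u w \<and> adj v w then 1 else 0)" for w
    by (simp add: adj_ind_def)
  from sum_indicator_gt_1 [OF assms(1) this *]
  obtain p q where "p \<noteq> q" "adj h p" "adj u p" "adj v p" "adj h q" "adj u q" "adj v q"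
    by metis
  then show False
    using w5 assms adj_sym unfolding wheel5_free_def by metis
qed

end

section \<open>Cuts\<close>

locale bipartitioned_ugraph = simple_ugraph +
  fixes A :: "'a set"
begin

definition same_side :: "'a \<Rightarrow> 'a \<Rightarrow> bool" where
  "same_side u v \<longleftrightarrow> (u \<in> A \<longleftrightarrow> v \<in> A)"

definition inner :: "'a \<Rightarrow> 'a \<Rightarrow> real" where
  "inner u v = (if same_side u v then E u v else 0)"

definition cross :: "'a \<Rightarrow> 'a \<Rightarrow> real" where
  "cross u v = (if same_side u v then 0 else E u v)"

definition missing :: "'a \<Rightarrow> 'a \<Rightarrow> real" where
  "missing u v = (if same_side u v then 0 else 1 - E u v)"

definition inner_deg :: "'a \<Rightarrow> real" where "inner_deg u = (\<Sum>v\<in>V. inner u v)"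
definition cross_deg :: "'a \<Rightarrow> real" where "cross_deg u = (\<Sum>v\<in>V. cross u v)"
definition missing_deg :: "'a \<Rightarrow> real" where "missing_deg u = (\<Sum>v\<in>V. missing u v)"
definition opposite_size :: "'a \<Rightarrow> real" where
  "opposite_size u = (\<Sum>v\<in>V. if same_side u v then 0 else 1)"

lemma same_side_sym: "same_side u v \<longleftrightarrow> same_side v u"
  by (auto simp: same_side_def)

lemma inner_sym: "inner u v = inner v u"
  and cross_sym: "cross u v = cross v u"
  and missing_sym: "missing u v = missing v u"
  by (simp_all add: inner_def cross_def missing_def same_side_sym [of u v] E_sym [of u v])

lemma inner_bounds: "0 \<le> inner u v" "inner u v \<le> 1"
  and cross_bounds: "0 \<le> cross u v" "cross u v \<le> 1"
  and missing_bounds: "0 \<le> missing u v" "missing u v \<le> 1"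
  by (simp_all add: inner_def cross_def missing_def E_bounds)

lemma degree_nonneg: "0 \<le> inner_deg u" "0 \<le> cross_deg u" "0 \<le> missing_deg u"
  by (simp_all add: inner_deg_def cross_deg_def missing_deg_def sum_nonneg inner_bounds
      cross_bounds missing_bounds)

lemma E_split: "E u v = inner u v + cross u v"
  by (simp add: inner_def cross_def)

lemma degree_split: "(\<Sum>v\<in>V. E u v) = inner_deg u + cross_deg u"
  by (simp add: E_split inner_deg_def cross_deg_def sum.distrib)

lemma cross_plus_missing_deg: "cross_deg u + missing_deg u = opposite_size u"
  unfolding cross_deg_def missing_deg_def opposite_size_def sum.distrib [symmetric]
  by (rule sum.cong) (auto simp: cross_def missing_def)

lemma opposite_size_in: "A \<subseteq> V \<Longrightarrow> u \<in> A \<Longrightarrow> opposite_size u = card V - card A"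
proof -
  assume *: "A \<subseteq> V" "u \<in> A"
  then have "opposite_size u = card (V - A)"
    using finite_V by (simp add: opposite_size_def same_side_def sum.If_cases Diff_eq)
  then show ?thesis
    using * finite_V by (simp add: card_Diff_subset finite_subset card_mono of_nat_diff)
qed

lemma opposite_size_notin: "A \<subseteq> V \<Longrightarrow> u \<notin> A \<Longrightarrow> opposite_size u = card A"
proof -
  assume *: "A \<subseteq> V" "u \<notin> A"
  then have "V \<inter> - {v. v \<notin> A} = A"
    by auto
  with * show ?thesis
    using finite_V by (simp add: opposite_size_def same_side_def sum.If_cases)
qed

lemma opposite_size_cases:
  "A \<subseteq> V \<Longrightarrow> opposite_size u = (if u \<in> A then real (card V) - card A else card A)"
  using opposite_size_in opposite_size_notin card_mono [OF finite_V] by (simp add: of_nat_diff)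

text \<open>Each crossing edge is counted from both ends, which explains the factors 2
  below.\<close>

definition cut :: real where "cut = (\<Sum>u\<in>V. cross_deg u)"

lemma sum_opposite_size:
  assumes "A \<subseteq> V"
  shows "(\<Sum>u\<in>V. opposite_size u) = 2 * (real (card A) * (real (card V) - card A))"
proof -
  have "(\<Sum>u\<in>V. opposite_size u) = (\<Sum>u\<in>A. opposite_size u) + (\<Sum>u\<in>V - A. opposite_size u)"
    using assms finite_V by (metis sum.subset_diff add.commute)
  also have "\<dots> = card A * (real (card V) - card A) + card (V - A) * card A"
    using assms by (simp add: opposite_size_cases)
  finally show ?thesis
    using assms finite_V by (simp add: card_Diff_subset finite_subset card_mono of_nat_diff)
qed

lemma sum_missing_deg:
  assumes "A \<subseteq> V"
  shows "(\<Sum>u\<in>V. missing_deg u) = 2 * (real (card A) * (real (card V) - card A)) - cut"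
  using sum_opposite_size [OF assms]
  by (simp add: cross_plus_missing_deg [symmetric] sum.distrib cut_def)

lemma cut_ge:
  assumes "A \<subseteq> V"
  shows "2 * (\<Sum>u\<in>A. \<Sum>v\<in>V - A. E u v) \<le> cut"
proof -
  have 1: "(\<Sum>v\<in>V - A. E u v) \<le> cross_deg u" if "u \<in> A" for u
  proof -
    have "(\<Sum>v\<in>V - A. E u v) = (\<Sum>v\<in>V - A. cross u v)"
      by (rule sum.cong) (use that in \<open>auto simp: cross_def same_side_def\<close>)
    also have "\<dots> \<le> cross_deg u"
      unfolding cross_deg_def by (rule sum_mono2) (auto simp: finite_V cross_bounds)
    finally show ?thesis .
  qed
  have 2: "(\<Sum>v\<in>A. E u v) \<le> cross_deg u" if "u \<in> V - A" for u
  proof -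
    have "(\<Sum>v\<in>A. E u v) = (\<Sum>v\<in>A. cross u v)"
      by (rule sum.cong) (use that in \<open>auto simp: cross_def same_side_def\<close>)
    also have "\<dots> \<le> cross_deg u"
      unfolding cross_deg_def by (rule sum_mono2) (auto simp: finite_V cross_bounds assms)
    finally show ?thesis .
  qed
  have "(\<Sum>u\<in>V - A. \<Sum>v\<in>A. E u v) = (\<Sum>u\<in>A. \<Sum>v\<in>V - A. E u v)"
    by (subst sum.swap) (simp add: E_sym)
  then have "2 * (\<Sum>u\<in>A. \<Sum>v\<in>V - A. E u v)
      = (\<Sum>u\<in>A. \<Sum>v\<in>V - A. E u v) + (\<Sum>u\<in>V - A. \<Sum>v\<in>A. E u v)"
    by simp
  also have "\<dots> \<le> (\<Sum>u\<in>A. cross_deg u) + (\<Sum>u\<in>V - A. cross_deg u)"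
    by (intro add_mono sum_mono 1 2)
  also have "\<dots> = cut"
    unfolding cut_def using assms finite_V by (metis sum.subset_diff add.commute)
  finally show ?thesis .
qed

text \<open>The weights \<open>sqrt (opposite_size u)\<close> form the Perron vector of the complete bipartite graph.\<close>

lemma sum_neighbours_sqrt_opposite_size:
  assumes A: "A \<subseteq> V"
  defines "r \<equiv> sqrt (card A * (real (card V) - card A))"
    and "y \<equiv> \<lambda>u. sqrt (opposite_size u)" and "y' \<equiv> \<lambda>u. sqrt (real (card V) - opposite_size u)"
  shows "(\<Sum>v\<in>V. E u v * y v) = y u * (r + inner_deg u) - y' u * missing_deg u"
proof -
  have a: "real (card A) \<le> card V"
    using A finite_V by (simp add: card_mono)
  \<comment> \<open>A neighbour inside the part has the same opposite part as \<open>u\<close>; for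
    a crossing neighbour the opposite part is that of \<open>u\<close>, of size
    \<open>card V - opposite_size u\<close>.\<close>
  have "E u v * y v = y u * inner u v + y' u * cross u v" for v
    using A by (auto simp: inner_def cross_def same_side_def y_def y'_def opposite_size_cases)
  then have "(\<Sum>v\<in>V. E u v * y v) = y u * inner_deg u + y' u * cross_deg u"
    by (simp add: sum.distrib inner_deg_def cross_deg_def sum_distrib_left)
  moreover have "y' u * opposite_size u = r * y u"
    using A a by (simp add: y_def y'_def r_def opposite_size_cases real_sqrt_mult mult_ac)
  then have "y' u * cross_deg u + y' u * missing_deg u = r * y u"
    unfolding cross_plus_missing_deg [symmetric] by (simp add: distrib_left)
  ultimately show ?thesis
    by (simp add: algebra_simps)
qed

text \<open>By symmetry of \<open>E\<close>, the eigenvector \<open>x\<close> is orthogonal to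
  \<open>E y - \<mu> y\<close>. This is an exact balance: at \<open>u\<close>, each edge inside a
  part gains \<open>y u\<close> and each missing cross pair costs \<open>y' u\<close>.\<close>

lemma weighted_eigen_equation:
  fixes x :: "'a \<Rightarrow> real"
  assumes A: "A \<subseteq> V" and eigen: "\<And>u. u \<in> V \<Longrightarrow> (\<Sum>v\<in>V. E u v * x v) = \<mu> * x u"
  defines "r \<equiv> sqrt (card A * (real (card V) - card A))"
    and "y \<equiv> \<lambda>u. sqrt (opposite_size u)" and "y' \<equiv> \<lambda>u. sqrt (real (card V) - opposite_size u)"
  shows "(\<Sum>u\<in>V. x u * (y u * (r + inner_deg u - \<mu>) - y' u * missing_deg u)) = 0"
proof -
  have "(\<Sum>u\<in>V. \<mu> * x u * y u) = (\<Sum>u\<in>V. (\<Sum>v\<in>V. E u v * x v) * y u)"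
    by (rule sum.cong) (simp_all add: eigen)
  also have "\<dots> = (\<Sum>u\<in>V. \<Sum>v\<in>V. E u v * x v * y u)"
    by (simp add: sum_distrib_right)
  also have "\<dots> = (\<Sum>v\<in>V. \<Sum>u\<in>V. E v u * x v * y u)"
    by (subst sum.swap) (simp only: E_sym)
  also have "\<dots> = (\<Sum>v\<in>V. x v * (\<Sum>u\<in>V. E v u * y u))"
    by (simp add: sum_distrib_left mult_ac)
  also have "\<dots> = (\<Sum>v\<in>V. x v * (y v * (r + inner_deg v) - y' v * missing_deg v))"
    unfolding r_def y_def y'_def sum_neighbours_sqrt_opposite_size [OF A] ..
  finally show ?thesis
    by (simp add: algebra_simps sum.distrib sum_subtractf)
qed

end

section \<open>Maximum cuts\<close>

abbreviation (in simple_ugraph) cut_of :: "'a set \<Rightarrow> real" where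
  "cut_of A \<equiv> bipartitioned_ugraph.cut G A"

text \<open>Moving one vertex \<open>w\<close> across changes the cut by
  \<open>2 * (inner_deg w - cross_deg w)\<close>, so a maximum cut is also locally optimal.\<close>

lemma (in simple_ugraph) max_cut_exists:
  obtains A where "A \<subseteq> V" "\<And>B. B \<subseteq> V \<Longrightarrow> cut_of B \<le> cut_of A"
    "\<And>w. w \<in> V \<Longrightarrow> bipartitioned_ugraph.inner_deg G A w \<le> bipartitioned_ugraph.cross_deg G A w"
proof -
  have "finite (cut_of ` Pow V)"
    using finite_V by simp
  then obtain A where A: "A \<subseteq> V" "\<And>B. B \<subseteq> V \<Longrightarrow> cut_of B \<le> cut_of A"
    using Max_in [of "cut_of ` Pow V"] Max_ge [of "cut_of ` Pow V"] by (fastforce simp del: Max_ge)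
  interpret P: bipartitioned_ugraph G A
    by unfold_locales
  have "P.inner_deg w \<le> P.cross_deg w" if w: "w \<in> V" for w
  proof -
    define B where "B = (if w \<in> A then A - {w} else insert w A)"
    interpret Q: bipartitioned_ugraph G B
      by unfold_locales
    have B: "v \<in> B \<longleftrightarrow> (if v = w then w \<notin> A else v \<in> A)" for v
      by (auto simp: B_def)
    \<comment> \<open>Only pairs containing \<open>w\<close> change; the pair of \<open>w\<close>
      with itself is corrected twice, harmlessly because \<open>E w w = 0\<close>.\<close>
    have "Q.cross u v = P.cross u v + (if u = w then P.inner u v - P.cross u v else 0)
        + (if v = w then P.inner u v - P.cross u v else 0)" for u v
      using E_self [of w]
      by (auto simp: B Q.cross_def P.cross_def P.inner_def Q.same_side_def P.same_side_def)
    then have "Q.cut = P.cut + (\<Sum>u\<in>V. \<Sum>v\<in>V. if u = w then P.inner u v - P.cross u v else 0)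
        + (\<Sum>u\<in>V. \<Sum>v\<in>V. if v = w then P.inner u v - P.cross u v else 0)"
      by (simp add: Q.cut_def P.cut_def Q.cross_deg_def P.cross_deg_def sum.distrib)
    also have "(\<Sum>u\<in>V. \<Sum>v\<in>V. if v = w then P.inner u v - P.cross u v else 0)
        = (\<Sum>u\<in>V. P.inner w u - P.cross w u)"
      using w finite_V by (simp add: P.inner_sym P.cross_sym)
    also have "(\<Sum>u\<in>V. \<Sum>v\<in>V. if u = w then P.inner u v - P.cross u v else 0)
        = (\<Sum>u\<in>V. P.inner w u - P.cross w u)"
      using w finite_V by (subst sum.swap) simp
    finally have "Q.cut = P.cut + 2 * (P.inner_deg w - P.cross_deg w)"
      by (simp add: sum_subtractf P.inner_deg_def P.cross_deg_def)
    moreover have "Q.cut \<le> P.cut"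
      using A(1) w by (intro A(2)) (auto simp: B_def)
    ultimately show ?thesis
      by simp
  qed
  with A that show thesis
    by blast
qed

section \<open>Stability\<close>

text \<open>The bound on \<open>\<mu>\<close> is the one that \<open>best_size_lower\<close>
  provides, so it covers both spectrally extremal graphs and graphs with at least
  \<open>best_size\<close> edges.\<close>

locale large_spectral_ugraph = wheel5_free_ugraph +
  fixes x :: "'a \<Rightarrow> real" and \<mu> :: real and z :: 'a
  assumes x_nonneg: "u \<in> V \<Longrightarrow> 0 \<le> x u"
    and x_le_1: "u \<in> V \<Longrightarrow> x u \<le> 1"
    and z: "z \<in> V" "x z = 1"
    and eigen: "u \<in> V \<Longrightarrow> (\<Sum>v\<in>V. E u v * x v) = \<mu> * x u"
    and \<mu>_ge: "card V / 2 + 1 - 2 / card V \<le> \<mu>"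
    and large: "10 ^ 13 \<le> card V"
begin

abbreviation n :: real where "n \<equiv> real (card V)"

lemma n_ge: "10 ^ 13 \<le> n"
  using large by (metis of_nat_le_iff of_nat_numeral of_nat_power)

lemma n_ge_10000: "10000 \<le> n"
  using n_ge by simp

lemma \<mu>_ge_half: "n / 2 \<le> \<mu>"
proof -
  have "2 / n \<le> 1"
    using n_ge by simp
  then show ?thesis
    using \<mu>_ge by linarith
qed

text \<open>The cut separates the neighbourhood \<open>N\<close> of \<open>z\<close> from the rest.
  As entries of \<open>x\<close> are at most 1, \<open>\<mu>^2\<close> is at most the degree sum
  over \<open>N\<close>, to which edges inside \<open>N\<close> contribute little.\<close>

lemma exists_large_cut:
  obtains A where "A \<subseteq> V" "n\<^sup>2 / 2 - n\<^sup>2 / 500000 \<le> cut_of A"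
proof -
  define N where "N = {v \<in> V. adj z v}"
  have N: "N \<subseteq> V" "finite N"
    using finite_V by (auto simp: N_def)
  interpret bipartitioned_ugraph G N
    by unfold_locales
  have EN: "E z v = (if v \<in> N then 1 else 0)" if "v \<in> V" for v
    using that by (simp add: N_def adj_ind_def)
  have "\<mu> = (\<Sum>v\<in>V. E z v * x v)"
    using eigen z by simp
  also have "\<dots> = (\<Sum>v\<in>V. if v \<in> N then x v else 0)"
    by (rule sum.cong) (simp_all add: EN)
  also have "\<dots> = (\<Sum>v\<in>N. x v)"
    using N finite_V by (simp add: sum.If_cases Int_absorb1)
  finally have "\<mu>\<^sup>2 = (\<Sum>v\<in>N. \<mu> * x v)"
    by (simp add: power2_eq_square sum_distrib_left)
  also have "\<dots> = (\<Sum>v\<in>N. \<Sum>w\<in>V. E v w * x w)"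
    using N by (intro sum.cong) (auto simp: eigen)
  also have "\<dots> \<le> (\<Sum>v\<in>N. \<Sum>w\<in>V. E v w)"
    by (intro sum_mono mult_left_le x_le_1 E_bounds)
  also have "\<dots> = (\<Sum>v\<in>N. \<Sum>w\<in>N. E v w) + (\<Sum>v\<in>N. \<Sum>w\<in>V - N. E v w)"
    using N finite_V by (simp add: sum.subset_diff [of N V] sum.distrib)
  \<comment> \<open>With \<open>z\<close> as hub, \<open>N\<close> spans no 4-cycle; this is the
    path-counting bound with \<open>k = 2000000\<close>.\<close>
  also have "(\<Sum>v\<in>N. \<Sum>w\<in>N. E v w) \<le> (card N)\<^sup>2 / 2000000 + (2000000 + 1) * real (card N)"
  proof (rule sum_degrees_C4_free_le)
    fix u v assume uv: "u \<in> N" "v \<in> N" "u \<noteq> v"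
    have "(\<Sum>w\<in>N. E u w * E v w) = (\<Sum>w\<in>N. E z w * E u w * E v w)"
      by (rule sum.cong) (use EN N in auto)
    also have "\<dots> \<le> 1"
      using uv N by (intro common_neighbours_le_1) (auto simp: N_def)
    finally show "(\<Sum>w\<in>N. E u w * E v w) \<le> 1" .
  qed (use N in auto)
  also have "\<dots> \<le> n\<^sup>2 / 2000000 + (2000000 + 1) * n"
    using N finite_V by (intro add_mono divide_right_mono mult_left_mono) (simp_all add: card_mono power_mono)
  also have "\<dots> \<le> n\<^sup>2 / 2000000 + n\<^sup>2 / 2000000"
  proof -
    \<comment> \<open>Holds once \<open>n\<close> exceeds about \<open>4 * 10 ^ 12\<close>; this is
      the most demanding use of the threshold \<open>10 ^ 13\<close>.\<close>
    have "(2000000 + 1) * n \<le> n / 2000000 * n"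
      using n_ge by (intro mult_right_mono) auto
    then show ?thesis
      by (simp add: power2_eq_square)
  qed
  finally have "\<mu>\<^sup>2 \<le> n\<^sup>2 / 1000000 + (\<Sum>v\<in>N. \<Sum>w\<in>V - N. E v w)"
    by simp
  moreover have "n\<^sup>2 / 4 \<le> \<mu>\<^sup>2"
    using power_mono [OF \<mu>_ge_half, of 2] by (simp add: power_divide)
  ultimately have "n\<^sup>2 / 2 - n\<^sup>2 / 500000 \<le> cut"
    using cut_ge [OF N(1)] by linarith
  with N(1) that show thesis
    by blast
qed

end

text \<open>The properties of a maximum cut that matter: it is nearly complete, and no vertex gains
  by changing sides.\<close>

locale large_cut_ugraph = large_spectral_ugraph + bipartitioned_ugraph +
  assumes A_subset: "A \<subseteq> V"
    and cut_large: "n\<^sup>2 / 2 - n\<^sup>2 / 500000 \<le> cut"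
    and inner_le_cross: "u \<in> V \<Longrightarrow> inner_deg u \<le> cross_deg u"
begin

text \<open>By \<open>cut_large\<close> there are at most \<open>n / 5000\<close> bad vertices, far fewer than the \<open>n / 100\<close> pairs
  that each of them misses.\<close>

definition bad :: "'a set" where "bad = {u \<in> V. n / 100 \<le> missing_deg u}"

definition good_inner_deg :: "'a \<Rightarrow> real" where "good_inner_deg u = (\<Sum>v\<in>V - bad. inner u v)"
definition bad_inner_deg :: "'a \<Rightarrow> real" where "bad_inner_deg u = (\<Sum>v\<in>bad. inner u v)"

lemma bad_subset: "bad \<subseteq> V" and finite_bad: "finite bad"
  using finite_V by (auto simp: bad_def)

lemma inner_deg_eq: "inner_deg u = good_inner_deg u + bad_inner_deg u"
  unfolding inner_deg_def good_inner_deg_def bad_inner_deg_def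
  using bad_subset finite_V by (rule sum.subset_diff)

lemma bad_inner_deg_nonneg: "0 \<le> bad_inner_deg u"
  by (simp add: bad_inner_deg_def sum_nonneg inner_bounds)

lemma bad_inner_deg_le: "bad_inner_deg u \<le> card bad"
  using sum_mono [of bad "inner u" "\<lambda>_. 1"] by (simp add: bad_inner_deg_def inner_bounds)

lemma cut_le: "cut \<le> 2 * (card A * (n - card A))"
  using sum_missing_deg [OF A_subset] sum_nonneg [of V missing_deg] degree_nonneg by simp

text \<open>The squared imbalance is \<open>n^2 - 4 a (n - a)\<close> with
  \<open>a = card A\<close>, and \<open>4 a (n - a)\<close> is at least twice the cut.\<close>

lemma parts_balanced: "\<bar>n - 2 * card A\<bar> \<le> n / 250"
proof -
  have "(n - 2 * card A)\<^sup>2 = n\<^sup>2 - 4 * (card A * (n - card A))"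
    by (simp add: power2_eq_square algebra_simps)
  also have "\<dots> \<le> n\<^sup>2 / 250000"
    using cut_le cut_large by simp
  also have "\<dots> \<le> (n / 250)\<^sup>2"
    by (simp add: power_divide)
  finally show ?thesis
    using abs_le_square_iff [of "n - 2 * card A" "n / 250"] by simp
qed

lemma card_A_bounds: "249 / 500 * n \<le> card A" "card A \<le> 251 / 500 * n"
proof -
  have "n - 2 * card A \<le> n / 250" "2 * card A - n \<le> n / 250"
    using parts_balanced unfolding abs_le_iff by auto
  then show "249 / 500 * n \<le> card A" "card A \<le> 251 / 500 * n"
    by simp_all
qed

lemma opposite_size_bounds: "249 / 500 * n \<le> opposite_size u" "opposite_size u \<le> 251 / 500 * n"
  using A_subset card_A_bounds by (auto simp: opposite_size_cases)

lemma card_bad_le: "card bad \<le> n / 5000"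
proof -
  have "card bad * (n / 100) \<le> (\<Sum>u\<in>bad. missing_deg u)"
    using sum_mono [of bad "\<lambda>_. n / 100" missing_deg] by (simp add: bad_def)
  also have "\<dots> \<le> (\<Sum>u\<in>V. missing_deg u)"
    using bad_subset finite_V by (intro sum_mono2) (auto simp: degree_nonneg)
  also have "\<dots> \<le> n\<^sup>2 / 500000"
  proof -
    have "0 \<le> (n - 2 * card A)\<^sup>2"
      by simp
    then have "4 * (card A * (n - card A)) \<le> n\<^sup>2"
      by (simp add: power2_eq_square algebra_simps)
    then show ?thesis
      using sum_missing_deg [OF A_subset] cut_large by simp
  qed
  finally have "card bad * n \<le> (n / 5000) * n"
    by (simp add: power2_eq_square mult.commute)
  then show ?thesis
    by (rule mult_right_le_imp_le) (use n_ge in simp)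
qed

lemma good_missing: "u \<in> V - bad \<Longrightarrow> missing_deg u < n / 100"
  by (auto simp: bad_def)

text \<open>Two good neighbours \<open>p\<close>, \<open>q\<close> of \<open>u\<close> in its own part miss few vertices of the other part, so
  two of the opposite neighbours of \<open>u\<close> would form a four-cycle with \<open>p\<close> and \<open>q\<close>.\<close>

lemma good_inner_deg_dichotomy:
  assumes "u \<in> V"
  shows "good_inner_deg u \<le> 1 \<or> cross_deg u \<le> n / 50 + 1"
proof (rule disjCI)
  assume "\<not> cross_deg u \<le> n / 50 + 1"
  show "good_inner_deg u \<le> 1"
  proof (rule ccontr)
    assume "\<not> ?thesis"
    then have gt: "1 < (\<Sum>v\<in>V - bad. inner u v)"
      by (simp add: good_inner_deg_def)
    have ind: "inner u v = (if same_side u v \<and> adj u v then 1 else 0)" for v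
      by (simp add: inner_def adj_ind_def)
    obtain p q where pq: "p \<in> V - bad" "q \<in> V - bad" "p \<noteq> q"
      "same_side u p" "same_side u q" "adj u p" "adj u q"
      using sum_indicator_gt_1 [OF _ ind gt] finite_V by (metis finite_Diff)
    \<comment> \<open>A crossing neighbour of \<open>u\<close> is either adjacent to both
      \<open>p\<close> and \<open>q\<close> or missing from one of them; the first kind occurs at
      most once around the hub \<open>u\<close>.\<close>
    have "cross u w \<le> E u w * E p w * E q w + (missing p w + missing q w)" for w
      using pq by (auto simp: cross_def missing_def same_side_def adj_ind_def)
    then have "cross_deg u \<le> (\<Sum>w\<in>V. E u w * E p w * E q w + (missing p w + missing q w))"
      unfolding cross_deg_def by (intro sum_mono)
    also have "\<dots> = (\<Sum>w\<in>V. E u w * E p w * E q w) + missing_deg p + missing_deg q"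
      by (simp add: sum.distrib missing_deg_def)
    also have "\<dots> \<le> 1 + n / 100 + n / 100"
      using pq finite_V common_neighbours_le_1 [of V u p q] good_missing
      by (intro add_mono) (auto intro: less_imp_le)
    finally show False
      using \<open>\<not> cross_deg u \<le> n / 50 + 1\<close> by simp
  qed
qed

lemma inner_deg_le:
  assumes "u \<in> V" "good_inner_deg u \<le> 1"
  shows "inner_deg u \<le> n / 5000 + 1"
  using assms inner_deg_eq [of u] bad_inner_deg_le [of u] card_bad_le by linarith

text \<open>A good vertex has crossing degree near \<open>n / 2\<close>, which excludes the second
  alternative of the dichotomy.\<close>

lemma good_good_inner_deg:
  assumes "u \<in> V - bad"
  shows "good_inner_deg u \<le> 1"
  using good_inner_deg_dichotomy [of u] good_missing [OF assms] cross_plus_missing_deg [of u]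
    opposite_size_bounds(1) [of u] n_ge assms by auto

text \<open>The degree of \<open>z\<close> is at least \<open>\<mu> \<ge> n / 2\<close>, and at
  least half of it crosses the cut, so \<open>z\<close> also falls under the first alternative. Its
  degree is then hardly more than the size of the opposite part.\<close>

lemma maximal_inner_deg: "good_inner_deg z \<le> 1" and \<mu>_le: "\<mu> \<le> 51 / 100 * n"
proof -
  have \<mu>: "\<mu> = (\<Sum>v\<in>V. E z v * x v)"
    using eigen z by simp
  also have "\<dots> \<le> (\<Sum>v\<in>V. E z v)"
    by (intro sum_mono mult_left_le x_le_1 E_bounds)
  finally have le: "\<mu> \<le> inner_deg z + cross_deg z"
    by (simp add: degree_split)
  show *: "good_inner_deg z \<le> 1"
    using good_inner_deg_dichotomy [OF z(1)] inner_le_cross [OF z(1)] le \<mu>_ge_half n_ge by auto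
  show "\<mu> \<le> 51 / 100 * n"
    using le inner_deg_le [OF z(1) *] cross_plus_missing_deg [of z] degree_nonneg(3) [of z]
      opposite_size_bounds(2) [of z] n_ge by auto
qed

text \<open>A good vertex sees all of \<open>X\<close> but fewer than \<open>n / 100\<close>
  vertices, each of weight at most 1.\<close>

lemma good_vertex_weight_aux:
  assumes u: "u \<in> V" "missing_deg u < n / 100" and X: "X \<subseteq> V" "\<And>v. v \<in> X \<Longrightarrow> \<not> same_side u v"
    and w: "w \<le> (\<Sum>v\<in>X. x v)"
  shows "w - n / 100 \<le> \<mu> * x u"
proof -
  have "w \<le> (\<Sum>v\<in>X. x v)"
    by (rule w)
  also have "\<dots> \<le> (\<Sum>v\<in>X. E u v * x v + missing u v)"
  proof (intro sum_mono)
    fix v assume v: "v \<in> X"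
    show "x v \<le> E u v * x v + missing u v"
      using x_le_1 [of v] v X by (auto simp: missing_def adj_ind_def)
  qed
  also have "\<dots> \<le> (\<Sum>v\<in>V. E u v * x v + missing u v)"
    using X(1) finite_V by (intro sum_mono2) (auto simp: E_bounds missing_bounds x_nonneg)
  also have "\<dots> = \<mu> * x u + missing_deg u"
    using u eigen by (simp add: sum.distrib missing_deg_def)
  finally show ?thesis
    using u by simp
qed

text \<open>Two rounds: a good vertex on the side of \<open>z\<close> sees almost the same opposite
  weight as \<open>z\<close>, so its entry is at least \<open>9 / 10\<close>; these heavy vertices
  then support the good vertices of the other side.\<close>

lemma good_vertex_weight:
  assumes "u \<in> V - bad"
  shows "1 / 2 \<le> x u"
proof -
  have \<mu>_pos: "0 < \<mu>"
    using \<mu>_ge_half n_ge by simp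
  have same: "9 / 10 \<le> x u" if u: "u \<in> V - bad" and zu: "same_side z u" for u
  proof -
    define X where "X = {v \<in> V. \<not> same_side u v}"
    have "499 / 1000 * n \<le> (\<Sum>v\<in>X. x v)"
    proof -
      have "\<mu> = (\<Sum>v\<in>V. E z v * x v)"
        using eigen z by simp
      also have "\<dots> \<le> (\<Sum>v\<in>V. (if \<not> same_side u v then x v else 0) + inner z v)"
      proof (intro sum_mono)
        fix v assume "v \<in> V"
        then show "E z v * x v \<le> (if \<not> same_side u v then x v else 0) + inner z v"
          using zu x_nonneg [of v] x_le_1 [of v] by (auto simp: inner_def adj_ind_def same_side_def)
      qed
      also have "\<dots> = (\<Sum>v\<in>X. x v) + inner_deg z"
        using finite_V by (simp add: sum.distrib inner_deg_def X_def sum.If_cases Int_def)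
      finally show ?thesis
        using \<mu>_ge_half inner_deg_le [OF z(1) maximal_inner_deg] n_ge by auto
    qed
    then have "499 / 1000 * n - n / 100 \<le> \<mu> * x u"
      using u good_missing by (intro good_vertex_weight_aux [of u X]) (auto simp: X_def)
    moreover have "\<mu> * x u < 51 / 100 * n * (9 / 10)" if "x u < 9 / 10"
      using \<mu>_le \<mu>_pos u that x_nonneg by (intro mult_le_less_imp_less) auto
    ultimately show ?thesis
      using n_ge by fastforce
  qed
  show ?thesis
  proof (cases "same_side z u")
    case True
    then show ?thesis
      using same [OF assms] by simp
  next
    case False
    define X where "X = {v \<in> V. \<not> same_side u v} - bad"
    have "opposite_size u = card {v \<in> V. \<not> same_side u v}"
      using finite_V by (simp add: opposite_size_def sum.If_cases Int_def)
    also have "card {v \<in> V. \<not> same_side u v} \<le> card X + card bad"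
    proof -
      have "card {v \<in> V. \<not> same_side u v} \<le> card (X \<union> bad)"
        unfolding X_def using finite_V finite_bad by (intro card_mono) auto
      then show ?thesis
        using card_Un_le [of X bad] by simp
    qed
    finally have "49 / 100 * n \<le> card X"
      using opposite_size_bounds(1) [of u] card_bad_le n_ge by auto
    moreover have "card X * (9 / 10) \<le> (\<Sum>v\<in>X. x v)"
    proof -
      have "9 / 10 \<le> x v" if "v \<in> X" for v
        using that False by (intro same) (auto simp: X_def same_side_def)
      then show ?thesis
        using sum_mono [of X "\<lambda>_. 9 / 10" x] by simp
    qed
    ultimately have "11 / 25 * n \<le> (\<Sum>v\<in>X. x v)"
      by linarith
    then have "11 / 25 * n - n / 100 \<le> \<mu> * x u"
      using assms good_missing by (intro good_vertex_weight_aux [of u X]) (auto simp: X_def)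
    moreover have "\<mu> * x u < 51 / 100 * n * (1 / 2)" if "x u < 1 / 2"
      using \<mu>_le \<mu>_pos assms that x_nonneg by (intro mult_le_less_imp_less) auto
    ultimately show ?thesis
      using n_ge by fastforce
  qed
qed

section \<open>Excluding bad vertices\<close>

lemma sum_good_bad_inner: "(\<Sum>u\<in>V - bad. bad_inner_deg u) = (\<Sum>s\<in>bad. good_inner_deg s)"
  unfolding bad_inner_deg_def good_inner_deg_def
  by (subst sum.swap) (simp only: inner_sym)

text \<open>All but at most \<open>card bad\<close> of the missing pairs at a bad vertex have a good
  other end. This charges the loss to good vertices, whose weights are bounded below, while bad ones
  may have tiny weight.\<close>

lemma sum_good_missing_ge:
  "(\<Sum>s\<in>bad. missing_deg s - card bad) \<le> (\<Sum>u\<in>V - bad. missing_deg u)"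
proof -
  have "(\<Sum>s\<in>bad. missing_deg s - card bad) \<le> (\<Sum>s\<in>bad. \<Sum>u\<in>V - bad. missing s u)"
  proof (rule sum_mono)
    fix s
    have "missing_deg s = (\<Sum>u\<in>V - bad. missing s u) + (\<Sum>u\<in>bad. missing s u)"
      unfolding missing_deg_def using bad_subset finite_V by (rule sum.subset_diff)
    moreover have "(\<Sum>u\<in>bad. missing s u) \<le> card bad"
      using sum_mono [of bad "missing s" "\<lambda>_. 1"] by (simp add: missing_bounds)
    ultimately show "missing_deg s - card bad \<le> (\<Sum>u\<in>V - bad. missing s u)"
      by simp
  qed
  also have "\<dots> = (\<Sum>u\<in>V - bad. \<Sum>s\<in>bad. missing u s)"
    by (subst sum.swap) (simp only: missing_sym)
  also have "\<dots> \<le> (\<Sum>u\<in>V - bad. missing_deg u)"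
    unfolding missing_deg_def
    using bad_subset finite_V by (intro sum_mono sum_mono2) (auto simp: missing_bounds)
  finally show ?thesis .
qed

text \<open>In both cases of the dichotomy the missing pairs far outnumber the inner edges: either
  the inner degree is tiny, or the crossing degree is and bounds it. The 3 is chosen to beat the
  total error 2 in \<open>bad_empty\<close>.\<close>

lemma bad_vertex_loss:
  assumes "s \<in> bad"
  shows "good_inner_deg s - (missing_deg s - card bad) / 4 \<le> - 3"
    and "inner_deg s \<le> missing_deg s / 2"
proof -
  have s: "s \<in> V" "n / 100 \<le> missing_deg s"
    using assms by (auto simp: bad_def)
  have "good_inner_deg s - (missing_deg s - card bad) / 4 \<le> - 3 \<and> inner_deg s \<le> missing_deg s / 2"
  proof -
    define N where "N = n"
    have N: "N / 100 \<le> missing_deg s" "card bad \<le> N / 5000" "10000 \<le> N" "249 / 500 * N \<le> opposite_size s"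
      using s card_bad_le n_ge_10000 opposite_size_bounds(1) [of s] by (simp_all add: N_def)
    show ?thesis
    proof (cases "good_inner_deg s \<le> 1")
      case True
      then have "inner_deg s \<le> N / 5000 + 1"
        using inner_deg_le [OF s(1)] by (simp add: N_def)
      with True N show ?thesis
        by (intro conjI; argo)
    next
      case False
      then have "cross_deg s \<le> N / 50 + 1"
        using good_inner_deg_dichotomy [OF s(1)] by (simp add: N_def)
      then show ?thesis
        using inner_le_cross [OF s(1)] cross_plus_missing_deg [of s] inner_deg_eq [of s]
          bad_inner_deg_nonneg [of s] N by (intro conjI; argo)
    qed
  qed
  then show "good_inner_deg s - (missing_deg s - card bad) / 4 \<le> - 3"
    and "inner_deg s \<le> missing_deg s / 2"
    by auto
qed

text \<open>Each summand of the weighted eigenvalue equation is bounded by \<open>Y * g u\<close>.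
  Double counting the pairs between good and bad vertices moves all gains and losses to the bad
  ones, where each loses at least 3, against a total error of
  \<open>n * (2 / n) = 2\<close>.\<close>

lemma bad_empty: "bad = {}"
proof (rule ccontr)
  assume "bad \<noteq> {}"
  define r where "r = sqrt (card A * (n - card A))"
  define y where "y u = sqrt (opposite_size u)" for u
  define y' where "y' u = sqrt (n - opposite_size u)" for u
  define Y where "Y = sqrt n"
  have Y_pos: "0 < Y"
    using n_ge by (simp add: Y_def)
  have y: "0 \<le> y u" "y u \<le> Y" for u
    using opposite_size_bounds [of u] n_ge unfolding y_def Y_def by (auto intro!: real_sqrt_le_mono)
  have y': "Y / 2 \<le> y' u" for u
  proof -
    have "sqrt (n / 4) \<le> y' u"
      unfolding y'_def using opposite_size_bounds [of u] n_ge by (intro real_sqrt_le_mono) auto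
    then show ?thesis
      by (simp add: Y_def real_sqrt_divide)
  qed
  \<comment> \<open>By the inequality of arithmetic and geometric means,
    \<open>r \<le> n / 2\<close>.\<close>
  have r: "r - \<mu> \<le> 2 / n - 1"
  proof -
    have "4 * (card A * (n - card A)) = n\<^sup>2 - (n - 2 * card A)\<^sup>2"
      by (simp add: power2_eq_square algebra_simps)
    also have "\<dots> \<le> n\<^sup>2"
      by simp
    finally have "card A * (n - card A) \<le> (n / 2)\<^sup>2"
      by (simp add: power_divide)
    then have "r \<le> n / 2"
      unfolding r_def by (intro real_le_lsqrt) auto
    then show ?thesis
      using \<mu>_ge by simp
  qed
  \<comment> \<open>The factor \<open>1 / 4\<close> at good vertices combines
    \<open>x u \<ge> 1 / 2\<close> with \<open>y' u \<ge> Y / 2\<close>.\<close>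
  define g where "g u = 2 / n + (if u \<in> bad then 0 else bad_inner_deg u - missing_deg u / 4)" for u
  have "x u * (y u * (r + inner_deg u - \<mu>) - y' u * missing_deg u) \<le> Y * g u" if u: "u \<in> V" for u
  proof -
    have x: "0 \<le> x u" "x u \<le> 1"
      using u x_nonneg x_le_1 by auto
    have "y u * (r + inner_deg u - \<mu>) \<le> y u * (2 / n + (inner_deg u - 1))"
      using y r by (intro mult_left_mono) auto
    moreover have "Y / 2 * missing_deg u \<le> y' u * missing_deg u"
      using y' degree_nonneg by (intro mult_right_mono) auto
    ultimately have "x u * (y u * (r + inner_deg u - \<mu>) - y' u * missing_deg u)
        \<le> x u * (y u * (2 / n + (inner_deg u - 1)) - Y / 2 * missing_deg u)"
      using x by (intro mult_left_mono) auto
    also have "\<dots> \<le> Y * g u"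
    proof (cases "u \<in> bad")
      case True
      \<comment> \<open>Here \<open>x u\<close> has no useful lower bound, so the missing pairs only
        serve to cancel the inner edges.\<close>
      have "y u * (2 / n + (inner_deg u - 1)) \<le> y u * (2 / n + inner_deg u)"
        using y by (intro mult_left_mono) auto
      also have "\<dots> \<le> Y * (2 / n + inner_deg u)"
        using y degree_nonneg by (intro mult_right_mono) auto
      also have "\<dots> \<le> Y * (2 / n + missing_deg u / 2)"
        using Y_pos bad_vertex_loss(2) [OF True] by (intro mult_left_mono) auto
      finally have "y u * (2 / n + (inner_deg u - 1)) - Y / 2 * missing_deg u \<le> Y * (2 / n)"
        by (simp add: algebra_simps)
      then have "x u * (y u * (2 / n + (inner_deg u - 1)) - Y / 2 * missing_deg u) \<le> x u * (Y * (2 / n))"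
        using x by (intro mult_left_mono)
      also have "\<dots> \<le> 1 * (Y * (2 / n))"
        using x Y_pos by (intro mult_right_mono) auto
      finally show ?thesis
        using True by (simp add: g_def)
    next
      case False
      then have good: "u \<in> V - bad"
        using u by simp
      have "x u * (y u * (2 / n + (inner_deg u - 1))) \<le> x u * (y u * (2 / n + bad_inner_deg u))"
        using x y good_good_inner_deg [OF good] inner_deg_eq [of u] by (intro mult_left_mono) auto
      also have "\<dots> \<le> 1 * (Y * (2 / n + bad_inner_deg u))"
        using x y bad_inner_deg_nonneg [of u] by (intro mult_mono mult_right_mono) auto
      finally have "x u * (y u * (2 / n + (inner_deg u - 1))) \<le> Y * (2 / n + bad_inner_deg u)"
        by simp
      moreover have "1 / 2 * (Y / 2 * missing_deg u) \<le> x u * (Y / 2 * missing_deg u)"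
        using good_vertex_weight [OF good] Y_pos degree_nonneg by (intro mult_right_mono) auto
      ultimately show ?thesis
        using False by (simp add: g_def algebra_simps)
    qed
    finally show ?thesis .
  qed
  then have "(\<Sum>u\<in>V. x u * (y u * (r + inner_deg u - \<mu>) - y' u * missing_deg u)) \<le> (\<Sum>u\<in>V. Y * g u)"
    by (intro sum_mono)
  then have "0 \<le> Y * (\<Sum>u\<in>V. g u)"
    using weighted_eigen_equation [OF A_subset eigen] by (simp add: r_def y_def y'_def sum_distrib_left)
  then have "0 \<le> (\<Sum>u\<in>V. g u)"
    using Y_pos by (simp add: zero_le_mult_iff)
  also have "(\<Sum>u\<in>V. g u)
      = 2 + (\<Sum>u\<in>V. if u \<in> bad then 0 else bad_inner_deg u - missing_deg u / 4)"
    using n_ge_10000 by (simp add: g_def sum.distrib)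
  finally have "- 2 \<le> (\<Sum>u\<in>V. if u \<in> bad then 0 else bad_inner_deg u - missing_deg u / 4)"
    by simp
  also have "\<dots> = (\<Sum>u\<in>V - bad. bad_inner_deg u) - (\<Sum>u\<in>V - bad. missing_deg u) / 4"
    using finite_V by (simp add: sum.If_cases Diff_eq sum_subtractf sum_divide_distrib Collect_neg_eq)
  also have "\<dots> \<le> (\<Sum>s\<in>bad. good_inner_deg s) - (\<Sum>s\<in>bad. missing_deg s - card bad) / 4"
    using sum_good_missing_ge by (simp add: sum_good_bad_inner)
  also have "\<dots> = (\<Sum>s\<in>bad. good_inner_deg s - (missing_deg s - card bad) / 4)"
    by (simp add: sum_subtractf flip: sum_divide_distrib)
  also have "\<dots> \<le> (\<Sum>s\<in>bad. - 3)"
    by (intro sum_mono bad_vertex_loss)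
  finally show False
    using \<open>bad \<noteq> {}\<close> finite_bad card_gt_0_iff [of bad] by simp
qed

lemma inner_deg_le_1: "u \<in> V \<Longrightarrow> inner_deg u \<le> 1"
  using good_good_inner_deg [of u] bad_empty by (simp add: inner_deg_eq bad_inner_deg_def)

end

text \<open>A maximum cut is at least as large as the neighbourhood cut and locally optimal, so it
  has no bad vertices.\<close>

lemma (in large_spectral_ugraph) near_bipartition_exists:
  obtains A where "A \<subseteq> V" "0 < card A" "card A < card V"
    "\<And>u. u \<in> V \<Longrightarrow> bipartitioned_ugraph.inner_deg G A u \<le> 1"
proof -
  obtain A where A: "A \<subseteq> V" "\<And>B. B \<subseteq> V \<Longrightarrow> cut_of B \<le> cut_of A"
    "\<And>w. w \<in> V \<Longrightarrow> bipartitioned_ugraph.inner_deg G A w \<le> bipartitioned_ugraph.cross_deg G A w"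
    using max_cut_exists by metis
  obtain B where B: "B \<subseteq> V" "n\<^sup>2 / 2 - n\<^sup>2 / 500000 \<le> cut_of B"
    by (rule exists_large_cut)
  interpret large_cut_ugraph G x \<mu> z A
    by unfold_locales (use A B(2) A(2) [OF B(1)] in \<open>auto intro: order_trans\<close>)
  have "249 / 500 * n \<le> card A" "card A \<le> 251 / 500 * n"
    using card_A_bounds by auto
  then have "0 < card A" "card A < card V"
    using n_ge_10000 by auto
  with A(1) show thesis
    using inner_deg_le_1 by (rule that)
qed

section \<open>Graphs with a matching inside each part\<close>

definition inner_matching :: "'a ugraph \<Rightarrow> 'a set \<Rightarrow> bool" where
  "inner_matching G A \<longleftrightarrow> (\<forall>u v w. {u, v} \<in> edges G \<longrightarrow> {u, w} \<in> edges G \<longrightarrow>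
     (u \<in> A \<longleftrightarrow> v \<in> A) \<longrightarrow> (u \<in> A \<longleftrightarrow> w \<in> A) \<longrightarrow> v = w)"

text \<open>If \<open>a\<close> or \<open>c\<close> lies on the side of the hub, the other three rim
  vertices lie opposite, and the middle one has two neighbours in its own part. Otherwise
  \<open>b\<close> and \<open>d\<close> must both join the side of the hub, which then has
  two.\<close>

lemma (in simple_ugraph) inner_matching_imp_wheel5_free:
  assumes "inner_matching G A"
  shows "wheel5_free G"
  unfolding wheel5_free_def
proof (intro allI impI)
  fix h a b c d
  assume hub: "adj h a" "adj h b" "adj h c" "adj h d" and rim: "adj a b" "adj b c" "adj c d" "adj d a"
  have m: "v = w" if "adj u v" "adj u w" "u \<in> A \<longleftrightarrow> v \<in> A" "u \<in> A \<longleftrightarrow> w \<in> A" for u v w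
    using assms that unfolding inner_matching_def by blast
  have "a \<noteq> b" "b \<noteq> c" "c \<noteq> d" "d \<noteq> a"
    using rim not_adj_self by metis+
  have rim': "adj b a" "adj c b" "adj d c" "adj a d"
    using rim by (simp_all add: insert_commute)
  show "a = c \<or> b = d"
  proof (rule ccontr)
    assume ne: "\<not> (a = c \<or> b = d)"
    consider "h \<in> A \<longleftrightarrow> a \<in> A" | "h \<in> A \<longleftrightarrow> c \<in> A" | "h \<in> A \<longleftrightarrow> a \<notin> A" "h \<in> A \<longleftrightarrow> c \<notin> A"
      by blast
    then show False
    proof cases
      case 1
      then have "h \<in> A \<longleftrightarrow> b \<notin> A" "h \<in> A \<longleftrightarrow> c \<notin> A" "h \<in> A \<longleftrightarrow> d \<notin> A"
        using m hub ne \<open>a \<noteq> b\<close> \<open>d \<noteq> a\<close> by metis+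
      then show False
        using m [of c b d] rim rim' ne by blast
    next
      case 2
      then have "h \<in> A \<longleftrightarrow> b \<notin> A" "h \<in> A \<longleftrightarrow> a \<notin> A" "h \<in> A \<longleftrightarrow> d \<notin> A"
        using m hub ne \<open>b \<noteq> c\<close> \<open>c \<noteq> d\<close> by metis+
      then show False
        using m [of a b d] rim rim' ne by blast
    next
      case 3
      then have "h \<in> A \<longleftrightarrow> b \<in> A" "h \<in> A \<longleftrightarrow> d \<in> A"
        using m [of b a c] m [of d a c] rim rim' ne by blast+
      then show False
        using m hub ne by metis
    qed
  qed
qed

context bipartitioned_ugraph
begin

lemma inner_matching_iff:
  "inner_matching G A \<longleftrightarrow> (\<forall>u\<in>V. inner_deg u \<le> 1)"
proof
  have ind: "inner u v = (if same_side u v \<and> adj u v then 1 else 0)" for u v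
    by (simp add: inner_def adj_ind_def)
  show "\<forall>u\<in>V. inner_deg u \<le> 1" if "inner_matching G A"
  proof (intro ballI leI notI)
    fix u assume "u \<in> V" "1 < inner_deg u"
    from sum_indicator_gt_1 [OF finite_V ind this(2) [unfolded inner_deg_def]]
    obtain p q where "p \<noteq> q" "same_side u p" "same_side u q" "adj u p" "adj u q"
      by metis
    with \<open>inner_matching G A\<close> show False
      unfolding inner_matching_def same_side_def by blast
  qed
  show "inner_matching G A" if le: "\<forall>u\<in>V. inner_deg u \<le> 1"
    unfolding inner_matching_def
  proof (intro allI impI, rule ccontr)
    fix u v w
    assume uvw: "adj u v" "adj u w" "u \<in> A \<longleftrightarrow> v \<in> A" "u \<in> A \<longleftrightarrow> w \<in> A" "v \<noteq> w"
    have "(\<Sum>p\<in>{v, w}. inner u p) \<le> inner_deg u"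
      unfolding inner_deg_def using uvw adj_in_V
      by (intro sum_mono2) (auto simp: finite_V inner_bounds)
    moreover have "(\<Sum>p\<in>{v, w}. inner u p) = 2"
      using uvw by (simp add: ind same_side_def)
    moreover have "inner_deg u \<le> 1"
      using le uvw adj_in_V by blast
    ultimately show False
      by simp
  qed
qed

text \<open>A larger \<open>\<mu>\<close> would make every factor of \<open>x u\<close> in the
  weighted eigenvalue equation negative. Both parts are nonempty, so that \<open>y\<close> is
  positive.\<close>

lemma eigenvalue_le_1_plus_sqrt:
  fixes x :: "'a \<Rightarrow> real"
  assumes A: "A \<subseteq> V" "0 < card A" "card A < card V"
    and matching: "inner_matching G A"
    and x: "\<And>u. u \<in> V \<Longrightarrow> 0 \<le> x u" "z \<in> V" "0 < x z"
    and eigen: "\<And>u. u \<in> V \<Longrightarrow> (\<Sum>v\<in>V. E u v * x v) = \<mu> * x u"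
  shows "\<mu> \<le> 1 + sqrt (card A * (real (card V) - card A))"
proof (rule ccontr)
  define r where "r = sqrt (card A * (real (card V) - card A))"
  define y where "y u = sqrt (opposite_size u)" for u
  define y' where "y' u = sqrt (real (card V) - opposite_size u)" for u
  assume "\<not> ?thesis"
  then have r: "1 + r < \<mu>"
    by (simp add: r_def)
  have y: "0 < y u" "0 \<le> y' u" for u
    using A by (auto simp: y_def y'_def opposite_size_cases)
  have lt: "y u * (r + inner_deg u - \<mu>) - y' u * missing_deg u < 0" if "u \<in> V" for u
  proof -
    have "r + inner_deg u - \<mu> < 0"
      using matching that r by (auto simp: inner_matching_iff)
    then have "y u * (r + inner_deg u - \<mu>) < 0"
      using y by (simp add: mult_pos_neg)
    moreover have "0 \<le> y' u * missing_deg u"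
      using y degree_nonneg by simp
    ultimately show ?thesis
      by linarith
  qed
  have "(\<Sum>u\<in>V. x u * (y u * (r + inner_deg u - \<mu>) - y' u * missing_deg u)) < (\<Sum>u\<in>V. 0)"
  proof (rule sum_strict_mono_ex1 [OF finite_V])
    show "\<forall>u\<in>V. x u * (y u * (r + inner_deg u - \<mu>) - y' u * missing_deg u) \<le> 0"
      using x(1) lt by (blast intro: mult_nonneg_nonpos less_imp_le)
    show "\<exists>u\<in>V. x u * (y u * (r + inner_deg u - \<mu>) - y' u * missing_deg u) < 0"
      using x(2,3) lt by (auto intro!: bexI [of _ z] mult_pos_neg)
  qed
  then show False
    using weighted_eigen_equation [OF A(1) eigen] by (simp add: r_def y_def y'_def)
qed

end

section \<open>Counting edges\<close>

context simple_ugraph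
begin

lemma sum_degrees: "(\<Sum>u\<in>V. \<Sum>v\<in>V. E u v) = 2 * real (card (edges G))"
proof -
  have fin: "finite (edges G)"
    using simple finite_V by (intro finite_subset [of "edges G" "Pow V"]) (auto simp: simple_graph_def)
  have "(\<Sum>u\<in>V. \<Sum>v\<in>V. E u v) = (\<Sum>u\<in>V. \<Sum>v\<in>V. \<Sum>e\<in>edges G. if e = {u, v} then 1 else 0)"
    using fin by (simp add: adj_ind_def)
  also have "\<dots> = (\<Sum>u\<in>V. \<Sum>e\<in>edges G. \<Sum>v\<in>V. if e = {u, v} then 1 else 0)"
    by (intro sum.cong refl sum.swap)
  also have "\<dots> = (\<Sum>e\<in>edges G. \<Sum>u\<in>V. \<Sum>v\<in>V. if e = {u, v} then 1 else 0)"
    by (rule sum.swap)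
  also have "\<dots> = (\<Sum>e\<in>edges G. 2)"
  proof (rule sum.cong)
    fix e assume "e \<in> edges G"
    then obtain a b where ab: "e = {a, b}" "a \<noteq> b" "a \<in> V" "b \<in> V"
      using simple by (auto simp: simple_graph_def card_2_iff)
    have split: "(if e = {u, v} then 1 else 0 :: real)
        = (if u = a then if v = b then 1 else 0 else 0) + (if u = b then if v = a then 1 else 0 else 0)" for u v
      using ab by (auto simp: doubleton_eq_iff)
    have inner: "(\<Sum>v\<in>V. if u = p then if v = q then 1 else 0 else 0) = (if u = p then 1 else 0 :: real)"
      if "q \<in> V" for u p q
      using that finite_V by (cases "u = p") simp_all
    show "(\<Sum>u\<in>V. \<Sum>v\<in>V. if e = {u, v} then 1 else 0 :: real) = 2"
      unfolding split sum.distrib inner [OF ab(3)] inner [OF ab(4)] using ab finite_V by simp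
  qed simp
  finally show ?thesis
    by simp
qed

end

context bipartitioned_ugraph
begin

text \<open>The handshake identity for the subgraph induced on one part.\<close>

lemma sum_inner_deg_side:
  assumes "B \<subseteq> V" "\<And>u v. u \<in> B \<Longrightarrow> v \<in> V \<Longrightarrow> same_side u v \<longleftrightarrow> v \<in> B"
  shows "(\<Sum>u\<in>B. inner_deg u) = 2 * real (card {e \<in> edges G. e \<subseteq> B})"
proof -
  interpret B: simple_ugraph "(B, {e \<in> edges G. e \<subseteq> B})"
    using simple assms(1) finite_V by unfold_locales (auto simp: simple_graph_def finite_subset)
  have "(\<Sum>u\<in>B. inner_deg u) = (\<Sum>u\<in>B. \<Sum>v\<in>B. adj_ind (B, {e \<in> edges G. e \<subseteq> B}) u v)"
  proof (rule sum.cong)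
    fix u assume u: "u \<in> B"
    have "inner_deg u = (\<Sum>v\<in>V. if v \<in> B then E u v else 0)"
      unfolding inner_deg_def inner_def using u assms(2) by (intro sum.cong) auto
    also have "\<dots> = (\<Sum>v\<in>B. E u v)"
      using assms(1) finite_V by (simp add: sum.If_cases Int_absorb1)
    also have "\<dots> = (\<Sum>v\<in>B. adj_ind (B, {e \<in> edges G. e \<subseteq> B}) u v)"
      using u by (intro sum.cong) (auto simp: adj_ind_def)
    finally show "inner_deg u = (\<Sum>v\<in>B. adj_ind (B, {e \<in> edges G. e \<subseteq> B}) u v)" .
  qed simp
  also have "\<dots> = 2 * real (card {e \<in> edges G. e \<subseteq> B})"
    using B.sum_degrees by simp
  finally show ?thesis .
qed

lemma card_edges_eq:
  assumes A: "A \<subseteq> V"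
  defines "B \<equiv> V - A"
  defines "mA \<equiv> card {e \<in> edges G. e \<subseteq> A}" and "mB \<equiv> card {e \<in> edges G. e \<subseteq> B}"
  shows "(\<Sum>u\<in>A. inner_deg u) = 2 * real mA" "(\<Sum>u\<in>B. inner_deg u) = 2 * real mB"
    "2 * real (card (edges G)) = 2 * real mA + 2 * real mB + cut"
proof -
  show 1: "(\<Sum>u\<in>A. inner_deg u) = 2 * real mA"
    unfolding mA_def using A by (intro sum_inner_deg_side) (auto simp: same_side_def)
  show 2: "(\<Sum>u\<in>B. inner_deg u) = 2 * real mB"
    unfolding mB_def by (intro sum_inner_deg_side) (auto simp: same_side_def B_def)
  have "(\<Sum>u\<in>V. inner_deg u) = (\<Sum>u\<in>B. inner_deg u) + (\<Sum>u\<in>A. inner_deg u)"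
    unfolding B_def using A finite_V by (rule sum.subset_diff)
  then show "2 * real (card (edges G)) = 2 * real mA + 2 * real mB + cut"
    using 1 2 by (simp add: sum_degrees [symmetric] degree_split sum.distrib cut_def)
qed

lemma card_B: "A \<subseteq> V \<Longrightarrow> card (V - A) = card V - card A"
  using finite_V by (simp add: card_Diff_subset finite_subset)

lemma card_edges_le:
  assumes A: "A \<subseteq> V" and matching: "inner_matching G A"
  shows "card (edges G) \<le> card A * (card V - card A) + card A div 2 + (card V - card A) div 2"
proof -
  define mA mB where "mA = card {e \<in> edges G. e \<subseteq> A}" and "mB = card {e \<in> edges G. e \<subseteq> V - A}"
  have le: "(\<Sum>u\<in>B. inner_deg u) \<le> card B" if "B \<subseteq> V" for B
    using sum_mono [of B inner_deg "\<lambda>_. 1"] matching that by (auto simp: inner_matching_iff)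
  have "2 * mA \<le> card A" "2 * mB \<le> card V - card A"
    using card_edges_eq(1,2) [OF A] le [of A] le [of "V - A"] A card_B
    by (auto simp: mA_def mB_def)
  then have "mA \<le> card A div 2" "mB \<le> (card V - card A) div 2"
    by simp_all
  moreover have "card A \<le> card V"
    using A finite_V by (simp add: card_mono)
  have "real (card (edges G)) \<le> real (mA + mB + card A * (card V - card A))"
    using card_edges_eq(3) [OF A] sum_missing_deg [OF A] sum_nonneg [of V missing_deg] degree_nonneg(3)
      \<open>card A \<le> card V\<close> by (simp add: mA_def mB_def of_nat_diff)
  then have "card (edges G) \<le> mA + mB + card A * (card V - card A)"
    by (simp only: of_nat_le_iff)
  ultimately show ?thesis
    by simp
qed

text \<open>By \<open>maximal\<close>, at most one vertex per part is unmatched, so twice the number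
  of edges inside a part is at least its size minus 1; integrality gives the rounded half.\<close>

lemma card_edges_complete:
  assumes A: "A \<subseteq> V"
    and complete: "\<And>u v. u \<in> V \<Longrightarrow> v \<in> V \<Longrightarrow> \<not> same_side u v \<Longrightarrow> adj u v"
    and maximal: "\<And>u v. u \<in> V \<Longrightarrow> v \<in> V \<Longrightarrow> same_side u v \<Longrightarrow> inner_deg u < 1 \<Longrightarrow> inner_deg v < 1 \<Longrightarrow> u = v"
  shows "card A * (card V - card A) + card A div 2 + (card V - card A) div 2 \<le> card (edges G)"
proof -
  define mA mB where "mA = card {e \<in> edges G. e \<subseteq> A}" and "mB = card {e \<in> edges G. e \<subseteq> V - A}"
  have ge: "real (card B) - 1 \<le> (\<Sum>u\<in>B. inner_deg u)" 
    if B: "B \<subseteq> V" "\<And>u v. u \<in> B \<Longrightarrow> v \<in> B \<Longrightarrow> same_side u v" for B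
  proof -
    define U where "U = {u \<in> B. inner_deg u < 1}"
    have fin: "finite B"
      using B finite_V finite_subset by blast
    have "card U \<le> Suc 0"
      unfolding U_def using B fin by (subst card_le_Suc0_iff_eq) (auto intro!: maximal)
    then have "real (card B) - 1 \<le> real (card B) - card U"
      by simp
    also have "\<dots> = (\<Sum>u\<in>B. if u \<in> U then 0 else 1)"
    proof -
      have "U \<subseteq> B" by (auto simp: U_def)
      then show ?thesis
        using fin by (simp add: sum.If_cases Diff_eq [symmetric] card_Diff_subset finite_subset card_mono of_nat_diff)
    qed
    also have "\<dots> \<le> (\<Sum>u\<in>B. inner_deg u)"
      by (intro sum_mono) (auto simp: U_def degree_nonneg)
    finally show ?thesis .
  qed
  have "card A \<le> card V"
    using A finite_V by (simp add: card_mono)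
  have "real (card A) - 1 \<le> 2 * real mA"
    using card_edges_eq(1) [OF A] ge [OF A] by (simp add: mA_def same_side_def)
  then have "card A div 2 \<le> mA"
    by linarith
  have "real (card (V - A)) - 1 \<le> 2 * real mB"
    using card_edges_eq(2) [OF A] ge [of "V - A"] by (simp add: mB_def same_side_def)
  then have "(card V - card A) div 2 \<le> mB"
    unfolding card_B [OF A] by linarith
  have "missing_deg u = 0" if "u \<in> V" for u
    unfolding missing_deg_def using complete that by (intro sum.neutral) (auto simp: missing_def adj_ind_def)
  then have "cut = 2 * (real (card A) * (real (card V) - card A))"
    using sum_missing_deg [OF A] by simp
  then have "real (card (edges G)) = real (mA + mB + card A * (card V - card A))"
    using card_edges_eq(3) [OF A] \<open>card A \<le> card V\<close> by (simp add: mA_def mB_def of_nat_diff)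
  then have "card (edges G) = mA + mB + card A * (card V - card A)"
    by (simp only: of_nat_eq_iff)
  with \<open>card A div 2 \<le> mA\<close> \<open>(card V - card A) div 2 \<le> mB\<close> show ?thesis
    by simp
qed

end

section \<open>Consequences for labelled graphs\<close>

lemma free_graphs_wheel5_iff:
  "G \<in> free_graphs n (wheel 5) \<longleftrightarrow> simple_graph G \<and> vertices G = {..<n} \<and> wheel5_free G"
  using contains_wheel5_iff [of G] by (auto simp: free_graphs_def)

text \<open>The Rayleigh quotient of the all-ones vector.\<close>

lemma lambda1_ge_average_degree:
  assumes "simple_graph G" "vertices G = {..<n}" "0 < n"
  shows "2 * real (card (edges G)) \<le> lambda1 G * n"
proof -
  interpret simple_ugraph G
    using assms by unfold_locales
  obtain x where "\<And>y. quad_form {..<n} (adj_ind G) y \<le> lambda1 G * sq_norm {..<n} y"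
    using lambda1_perron [OF assms(2,3)] by metis
  from this [of "\<lambda>_. 1"] show ?thesis
    using sum_degrees assms(2) by (simp add: quad_form_def sq_norm_def)
qed

lemma near_bipartition_of_free_graph:
  assumes G: "G \<in> free_graphs n (wheel 5)" and n: "10 ^ 13 \<le> n"
    and large: "n / 2 + 1 - 2 / n \<le> lambda1 G"
  obtains A where "A \<subseteq> {..<n}" "0 < card A" "card A < n" "inner_matching G A"
proof -
  have V: "simple_graph G" "vertices G = {..<n}" "wheel5_free G"
    using G by (auto simp: free_graphs_wheel5_iff)
  have "0 < n"
    using n by (simp add: less_le_trans [of 0 "10 ^ 13"])
  obtain x where x: "\<And>v. v < n \<Longrightarrow> 0 \<le> x v" "\<exists>v<n. 0 < x v"
    "\<And>u. u < n \<Longrightarrow> (\<Sum>v<n. adj_ind G u v * x v) = lambda1 G * x u"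
    using lambda1_perron [OF V(2) \<open>0 < n\<close>] by metis
  have "Max (x ` {..<n}) \<in> x ` {..<n}"
    using \<open>0 < n\<close> by (intro Max_in) auto
  then obtain z where "z < n" "x z = Max (x ` {..<n})"
    by auto
  then have z: "z < n" "\<And>v. v < n \<Longrightarrow> x v \<le> x z"
    by simp_all
  have pos: "0 < x z"
    using x(2) z by (meson less_le_trans)
  interpret large_spectral_ugraph G "\<lambda>v. x v / x z" "lambda1 G" z
  proof unfold_locales
    fix u assume "u \<in> vertices G"
    then show "(\<Sum>v\<in>vertices G. adj_ind G u v * (x v / x z)) = lambda1 G * (x u / x z)"
      using x(3) [of u] V by (simp flip: sum_divide_distrib)
  qed (use V x z pos n large in auto)
  show thesis
  proof (rule near_bipartition_exists)
    fix A assume A: "A \<subseteq> vertices G" "0 < card A" "card A < card (vertices G)"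
      "\<And>u. u \<in> vertices G \<Longrightarrow> bipartitioned_ugraph.inner_deg G A u \<le> 1"
    interpret bipartitioned_ugraph G A
      by unfold_locales
    show thesis
      using A V by (intro that [of A]) (auto simp: inner_matching_iff)
  qed
qed

lemma lambda1_le_1_plus_sqrt:
  assumes V: "simple_graph G" "vertices G = {..<n}"
    and A: "A \<subseteq> {..<n}" "0 < card A" "card A < n" "inner_matching G A"
  shows "lambda1 G \<le> 1 + sqrt (card A * (real n - card A))"
proof -
  interpret bipartitioned_ugraph G A
    using V by unfold_locales
  have "0 < n"
    using A by simp
  obtain x where x: "\<And>v. v < n \<Longrightarrow> 0 \<le> x v" "\<exists>v<n. 0 < x v"
    "\<And>u. u < n \<Longrightarrow> (\<Sum>v<n. adj_ind G u v * x v) = lambda1 G * x u"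
    using lambda1_perron [OF V(2) \<open>0 < n\<close>] by metis
  then show ?thesis
    using eigenvalue_le_1_plus_sqrt [of x _ "lambda1 G"] A V by auto
qed

text \<open>Adding the edge does not decrease the form at \<open>x\<close>, but extremality forbids
  a larger eigenvalue. So \<open>x\<close> also maximises the Rayleigh quotient of the new graph and
  is an eigenvector of both graphs for the same value.\<close>

lemma SPEX_add_edge:
  assumes G: "G \<in> SPEX_family n F" and uv: "u < n" "v < n" "u \<noteq> v" "{u, v} \<notin> edges G"
    and free: "({..<n}, insert {u, v} (edges G)) \<in> free_graphs n F"
    and x: "\<And>w. w < n \<Longrightarrow> 0 \<le> x w"
    and eigen: "\<And>w. w < n \<Longrightarrow> (\<Sum>t<n. adj_ind G w t * x t) = lambda1 G * x w"
  shows "x v = 0"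
proof -
  define H where "H = ({..<n}, insert {u, v} (edges G))"
  have H: "vertices H = {..<n}" "0 < n"
    using uv by (auto simp: H_def)
  have "lambda1 H \<le> lambda1 G"
    using G free finite_free_graphs [of n F] by (auto simp: SPEX_family_def H_def intro!: Max_ge)
  have E: "adj_ind H w t = adj_ind G w t + (if w = u then if t = v then 1 else 0 else 0)
      + (if w = v then if t = u then 1 else 0 else 0)" for w t
    using uv by (auto simp: adj_ind_def H_def doubleton_eq_iff insert_commute)
  have inner: "(\<Sum>t<n. (if w = p then if t = q then 1 else 0 else 0) * x t) = (if w = p then x q else 0)"
    if "q < n" for w p q
    using that by (cases "w = p") (simp_all add: if_distrib [of "\<lambda>z. z * _"] cong: if_cong)
  have Hx: "(\<Sum>t<n. adj_ind H w t * x t)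
      = (\<Sum>t<n. adj_ind G w t * x t) + (if w = u then x v else 0) + (if w = v then x u else 0)" for w
    unfolding E distrib_right sum.distrib inner [OF uv(1)] inner [OF uv(2)] ..
  have H_le: "quad_form {..<n} (adj_ind H) y \<le> lambda1 G * sq_norm {..<n} y" for y
  proof -
    have "quad_form {..<n} (adj_ind H) y \<le> lambda1 H * sq_norm {..<n} y"
      using lambda1_perron [OF H] by metis
    also have "\<dots> \<le> lambda1 G * sq_norm {..<n} y"
      using \<open>lambda1 H \<le> lambda1 G\<close> sq_norm_nonneg by (intro mult_right_mono)
    finally show ?thesis .
  qed
  have "quad_form {..<n} (adj_ind G) x \<le> quad_form {..<n} (adj_ind H) x"
    unfolding quad_form_eq Hx using x uv by (intro sum_mono mult_left_mono) auto
  moreover have "quad_form {..<n} (adj_ind G) x = lambda1 G * sq_norm {..<n} x"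
    using eigen by (intro quad_form_eigenvector) auto
  ultimately have "quad_form {..<n} (adj_ind H) x = lambda1 G * sq_norm {..<n} x"
    using H_le [of x] by simp
  moreover have "adj_ind H w t = adj_ind H t w" for w t
    by (simp add: adj_ind_def insert_commute)
  \<comment> \<open>At \<open>u\<close> this equation differs from that of \<open>G\<close> exactly
    by the term \<open>x v\<close>.\<close>
  ultimately have "(\<Sum>t<n. adj_ind H u t * x t) = lambda1 G * x u"
    using uv H_le by (intro rayleigh_maximizer_eigenvector [of "{..<n}"]) auto
  then show ?thesis
    using Hx [of u] eigen [OF uv(1)] uv by simp
qed

lemma inner_matching_insert_edge:
  assumes "inner_matching G A"
    and "(u \<in> A \<longleftrightarrow> v \<in> A) \<Longrightarrow>
      (\<forall>w. (u \<in> A \<longleftrightarrow> w \<in> A) \<longrightarrow> {u, w} \<notin> edges G \<and> {v, w} \<notin> edges G)"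
  shows "inner_matching (V, insert {u, v} (edges G)) A"
  using assms unfolding inner_matching_def
  by (auto simp: doubleton_eq_iff)

text \<open>An addable edge would force a zero of the Perron vector, so the vector must first be
  shown positive without knowing that \<open>G\<close> is connected: positivity spreads across the
  cut, since a pair missing there would itself be addable.\<close>

lemma card_edges_SPEX_ge:
  assumes G: "G \<in> SPEX_family n (wheel 5)"
    and A: "A \<subseteq> {..<n}" "0 < card A" "card A < n" "inner_matching G A"
  shows "card A * (n - card A) + card A div 2 + (n - card A) div 2 \<le> card (edges G)"
proof -
  have V: "simple_graph G" "vertices G = {..<n}"
    using G by (auto simp: SPEX_family_def free_graphs_wheel5_iff)
  interpret bipartitioned_ugraph G A
    using V by unfold_locales
  have "0 < n"
    using A by simp
  obtain x where x: "\<And>v. v < n \<Longrightarrow> 0 \<le> x v" "\<exists>v<n. 0 < x v"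
    "\<And>u. u < n \<Longrightarrow> (\<Sum>v<n. adj_ind G u v * x v) = lambda1 G * x u"
    using lambda1_perron [OF V(2) \<open>0 < n\<close>] by metis
  have add: "x v = 0"
    if uv: "u < n" "v < n" "u \<noteq> v" "\<not> adj u v"
      and opp: "same_side u v \<Longrightarrow> inner_deg u < 1 \<and> inner_deg v < 1" for u v
  proof -
    have iso: "\<not> adj u w" if "inner_deg u < 1" "same_side u w" for u w
    proof
      assume "adj u w"
      then have "inner u w \<le> inner_deg u"
        unfolding inner_deg_def using adj_in_V finite_V inner_bounds by (intro member_le_sum) auto
      then show False
        using that \<open>adj u w\<close> by (simp add: inner_def adj_ind_def)
    qed
    have H: "simple_graph ({..<n}, insert {u, v} (edges G))"
      using V uv by (auto simp: simple_graph_def)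
    have "inner_matching ({..<n}, insert {u, v} (edges G)) A"
      using A(4) iso opp by (intro inner_matching_insert_edge) (auto simp: same_side_def)
    then have "({..<n}, insert {u, v} (edges G)) \<in> free_graphs n (wheel 5)"
      using simple_ugraph.inner_matching_imp_wheel5_free [OF simple_ugraph.intro [OF H]] H
      by (simp add: free_graphs_wheel5_iff)
    with G uv x show ?thesis
      by (intro SPEX_add_edge [of G n "wheel 5" u v x]) auto
  qed
  have pos_step: "0 < x b" if "a < n" "b < n" "0 < x a" "\<not> same_side a b" for a b
  proof -
    have "adj b a"
      using add [of b a] that same_side_sym [of a b] by (cases "a = b") (auto simp: same_side_def)
    then have "x a \<le> (\<Sum>v<n. adj_ind G b v * x v)"
      using that x(1) member_le_sum [of a "{..<n}" "\<lambda>v. adj_ind G b v * x v"] E_bounds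
      by (auto simp: adj_ind_def)
    then show ?thesis
      using x that by (metis less_le less_le_trans mult_zero_right not_less)
  qed
  obtain z where z: "z < n" "0 < x z"
    using x(2) by blast
  \<comment> \<open>A vertex opposite to \<open>z\<close>, needed to carry positivity back to the
    side of \<open>z\<close>.\<close>
  have "\<exists>b<n. \<not> same_side z b"
  proof (cases "z \<in> A")
    case True
    have "\<not> {..<n} \<subseteq> A"
      using A by (metis card_lessThan card_mono finite_lessThan finite_subset leD)
    then show ?thesis
      using True by (auto simp: same_side_def)
  next
    case False
    have "A \<noteq> {}"
      using A by auto
    then show ?thesis
      using False A by (auto simp: same_side_def)
  qed
  then obtain b where b: "b < n" "\<not> same_side z b"
    by blast
  have pos: "0 < x v" if "v < n" for v
  proof (cases "same_side z v")
    case True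
    then have "\<not> same_side b v"
      using b by (auto simp: same_side_def)
    then show ?thesis
      using pos_step [OF z(1) b(1) z(2) b(2)] pos_step [of b v] b that by blast
  next
    case False
    then show ?thesis
      using pos_step z that by blast
  qed
  have "card A * (card (vertices G) - card A) + card A div 2 + (card (vertices G) - card A) div 2
      \<le> card (edges G)"
  proof (rule card_edges_complete)
    show "A \<subseteq> vertices G"
      using A V by simp
    show "adj u v" if "u \<in> vertices G" "v \<in> vertices G" "\<not> same_side u v" for u v
      using add [of u v] pos [of v] that V by (auto simp: same_side_def)
    show "u = v" if uv: "u \<in> vertices G" "v \<in> vertices G" "same_side u v" "inner_deg u < 1" "inner_deg v < 1" for u v
    proof (rule ccontr)
      assume "u \<noteq> v"
      have "inner u v \<le> inner_deg u"
        unfolding inner_deg_def using uv finite_V inner_bounds by (intro member_le_sum) auto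
      then have "\<not> adj u v"
        using uv by (auto simp: inner_def adj_ind_def)
      then show False
        using add [of u v] pos [of v] uv \<open>u \<noteq> v\<close> V by auto
    qed
  qed
  then show ?thesis
    using V by simp
qed

section \<open>Comparison with an explicit graph\<close>

text \<open>A complete bipartite graph with parts \<open>{..<a}\<close> and \<open>{a..<n}\<close> together with the matching
  \<open>{0, 1}, {2, 3}, \<dots>\<close>, which does not join the two parts if \<open>a\<close> is even.\<close>

definition matched_bipartite :: "nat \<Rightarrow> nat \<Rightarrow> nat ugraph" where
  "matched_bipartite n a = ({..<n},
     {{i, j} | i j. i < a \<and> a \<le> j \<and> j < n} \<union> {{2 * i, Suc (2 * i)} | i. Suc (2 * i) < n})"

lemma matched_bipartite_adj_iff:
  "{u, v} \<in> edges (matched_bipartite n a) \<longleftrightarrow>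
    u < a \<and> a \<le> v \<and> v < n \<or> v < a \<and> a \<le> u \<and> u < n \<or>
    u < n \<and> v < n \<and> (even u \<and> v = Suc u \<or> even v \<and> u = Suc v)"
proof -
  have "(\<exists>i. {u, v} = {2 * i, Suc (2 * i)} \<and> Suc (2 * i) < n) \<longleftrightarrow>
      u < n \<and> v < n \<and> (even u \<and> v = Suc u \<or> even v \<and> u = Suc v)"
    by (auto simp: doubleton_eq_iff elim!: evenE)
  moreover have "(\<exists>i j. {u, v} = {i, j} \<and> i < a \<and> a \<le> j \<and> j < n) \<longleftrightarrow>
      u < a \<and> a \<le> v \<and> v < n \<or> v < a \<and> a \<le> u \<and> u < n"
    by (auto simp: doubleton_eq_iff)
  ultimately show ?thesis
    by (simp add: matched_bipartite_def)
qed

lemma matched_bipartite_free: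
  assumes "a \<le> n"
  shows "simple_graph (matched_bipartite n a)" "vertices (matched_bipartite n a) = {..<n}"
    "inner_matching (matched_bipartite n a) {..<a}" "matched_bipartite n a \<in> free_graphs n (wheel 5)"
proof -
  show 1: "simple_graph (matched_bipartite n a)" "vertices (matched_bipartite n a) = {..<n}"
    using assms by (auto simp: matched_bipartite_def simple_graph_def)
  show 2: "inner_matching (matched_bipartite n a) {..<a}"
    unfolding inner_matching_def matched_bipartite_adj_iff by (auto simp: not_less)
  show "matched_bipartite n a \<in> free_graphs n (wheel 5)"
    using 1 simple_ugraph.inner_matching_imp_wheel5_free [OF simple_ugraph.intro [OF 1(1)] 2]
    by (simp add: free_graphs_wheel5_iff)
qed

text \<open>Rounding both parts separately loses a pair only when both are odd, the case of
  \<open>halves_Suc\<close>.\<close>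

lemma halves_eq:
  fixes a n :: nat
  assumes "a \<le> n" "odd n \<or> even a"
  shows "a div 2 + (n - a) div 2 = n div 2"
proof -
  obtain b where "n = a + b"
    using assms(1) le_Suc_ex by blast
  then show ?thesis
    using assms(2) by simp presburger
qed
lemma halves_Suc:
  fixes a n :: nat
  assumes "a \<le> n" "even n" "odd a"
  shows "Suc (a div 2 + (n - a) div 2) = n div 2"
proof -
  obtain b where "n = a + b"
    using assms(1) le_Suc_ex by blast
  then show ?thesis
    using assms(2,3) by (auto elim!: oddE)
qed

context
  fixes n a :: nat
  assumes a: "0 < a" "a < n" "even a"
begin

interpretation bipartitioned_ugraph "matched_bipartite n a" "{..<a}"
  using matched_bipartite_free a by unfold_locales auto

lemma matched_bipartite_complete:
  "u < n \<Longrightarrow> v < n \<Longrightarrow> \<not> same_side u v \<Longrightarrow> adj u v"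
  by (auto simp: matched_bipartite_adj_iff same_side_def)

lemma matched_bipartite_inner_deg:
  assumes "u < n" "u \<noteq> n - 1 \<or> even n"
  shows "1 \<le> inner_deg u"
proof -
  define p where "p = (if even u then Suc u else u - 1)"
  have p: "p < n" "adj u p" "same_side u p"
    using assms a by (auto simp: p_def matched_bipartite_adj_iff same_side_def elim!: oddE evenE)
  then have "inner u p \<le> inner_deg u"
    unfolding inner_deg_def using finite_V inner_bounds matched_bipartite_free(2) a
    by (intro member_le_sum) auto
  then show ?thesis
    using p by (simp add: inner_def adj_ind_def)
qed

lemma card_edges_matched_bipartite:
  "a * (n - a) + n div 2 \<le> card (edges (matched_bipartite n a))"
proof -
  have V: "vertices (matched_bipartite n a) = {..<n}"
    using a by (intro matched_bipartite_free) simp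
  have "a * (n - a) + a div 2 + (n - a) div 2 \<le> card (edges (matched_bipartite n a))"
  proof -
    have "card {..<a} * (card V - card {..<a}) + card {..<a} div 2 + (card V - card {..<a}) div 2
        \<le> card (edges (matched_bipartite n a))"
    proof (rule card_edges_complete)
      fix u v assume "u \<in> V" "v \<in> V" "inner_deg u < 1" "inner_deg v < 1"
      then show "u = v"
        using matched_bipartite_inner_deg [of u] matched_bipartite_inner_deg [of v] V by auto
    qed (use V a matched_bipartite_complete in auto)
    then show ?thesis
      by (simp add: V)
  qed
  moreover have "a div 2 + (n - a) div 2 = n div 2"
    using a by (intro halves_eq) auto
  ultimately show ?thesis
    by simp
qed

text \<open>For even \<open>n\<close> both matchings are perfect, so the Perron vector of the
  complete bipartite graph remains an eigenvector, with its eigenvalue raised by 1.\<close>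

lemma lambda1_matched_bipartite:
  assumes "even n"
  shows "1 + sqrt (a * (real n - a)) \<le> lambda1 (matched_bipartite n a)"
proof -
  have V: "vertices (matched_bipartite n a) = {..<n}"
    using a by (intro matched_bipartite_free) simp
  define y where "y u = sqrt (opposite_size u)" for u
  have "(\<Sum>v<n. E u v * y v) = (1 + sqrt (a * (real n - a))) * y u" if "u \<in> {..<n}" for u
  proof -
    have "inner_deg u = 1"
      using matched_bipartite_inner_deg [of u] matched_bipartite_free(3) [of a n] assms a that
      by (force simp: inner_matching_iff V)
    moreover have "missing_deg u = 0"
      unfolding missing_deg_def using that matched_bipartite_complete
      by (intro sum.neutral) (auto simp: missing_def adj_ind_def V)
    ultimately show ?thesis
      using sum_neighbours_sqrt_opposite_size [of u] a by (auto simp: V y_def algebra_simps)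
  qed
  then have "quad_form {..<n} E y = (1 + sqrt (a * (real n - a))) * sq_norm {..<n} y"
    by (rule quad_form_eigenvector)
  moreover have "quad_form {..<n} E y \<le> lambda1 (matched_bipartite n a) * sq_norm {..<n} y"
    using lambda1_perron [OF V] a by (metis gr_zeroI not_less_zero)
  moreover have "0 < sq_norm {..<n} y"
  proof -
    have "0 < opposite_size 0"
      using a opposite_size_cases [of 0] by (auto simp: V)
    then have "sq_norm {..<n} y \<noteq> 0"
      using a by (auto simp: sq_norm_eq_0_iff y_def intro!: bexI [of _ 0])
    then show ?thesis
      using sq_norm_nonneg [of "{..<n}" y] by simp
  qed
  ultimately show ?thesis
    by simp
qed

end

text \<open>An even number nearest to \<open>n / 2\<close>; evenness keeps the matched pairs inside
  the parts.\<close>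

definition best_part :: "nat \<Rightarrow> nat" where
  "best_part n = 2 * ((n + 2) div 4)"

text \<open>Eventually shown to be \<open>ex_number n (wheel 5)\<close> for large
  \<open>n\<close>.\<close>

definition best_size :: "nat \<Rightarrow> nat" where
  "best_size n = best_part n * (n - best_part n) + n div 2"

section \<open>Arithmetic of the extremal edge number\<close>

lemma four_times_product: "a \<le> n \<Longrightarrow> 4 * int (a * (n - a)) = (int n)\<^sup>2 - (int n - 2 * int a)\<^sup>2"
  by (simp add: of_nat_diff power2_eq_square algebra_simps)

lemma best_part_product:
  assumes "4 \<le> n"
  shows "0 < best_part n" "best_part n < n" "even (best_part n)"
    and "even n \<Longrightarrow> (int n)\<^sup>2 - 4 \<le> 4 * int (best_part n * (n - best_part n))"
    and "odd n \<Longrightarrow> 4 * int (best_part n * (n - best_part n)) = (int n)\<^sup>2 - 1"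
proof -
  show 1: "0 < best_part n" "best_part n < n" "even (best_part n)"
    using assms unfolding best_part_def by (presburger+)
  have d: "even n \<and> (int n - 2 * int (best_part n) = 0 \<or> int n - 2 * int (best_part n) = - 2) \<or>
      odd n \<and> (int n - 2 * int (best_part n) = 1 \<or> int n - 2 * int (best_part n) = - 1)"
    unfolding best_part_def by presburger
  have sq: "4 * int (best_part n * (n - best_part n)) = (int n)\<^sup>2 - (int n - 2 * int (best_part n))\<^sup>2"
    using 1 by (intro four_times_product) simp
  show "even n \<Longrightarrow> (int n)\<^sup>2 - 4 \<le> 4 * int (best_part n * (n - best_part n))"
    unfolding sq using d by auto
  show "odd n \<Longrightarrow> 4 * int (best_part n * (n - best_part n)) = (int n)\<^sup>2 - 1"
    unfolding sq using d by auto
qed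

text \<open>For even \<open>n\<close> the product can exceed that of \<open>best_part n\<close> by
  at most 1. For even \<open>a\<close> parity rules this out, and for odd \<open>a\<close> the pair
  lost to rounding offsets it. For odd \<open>n\<close> the product of \<open>best_part n\<close> is
  already maximal.\<close>

lemma best_size_max:
  assumes n: "4 \<le> n" and a: "a \<le> n"
  shows "a * (n - a) + a div 2 + (n - a) div 2 \<le> best_size n"
proof -
  define p q where "p = a * (n - a)" and "q = best_part n * (n - best_part n)"
  have p: "4 * int p = (int n)\<^sup>2 - (int n - 2 * int a)\<^sup>2"
    unfolding p_def using a by (rule four_times_product)
  have "even q"
    using best_part_product(3) [OF n] by (simp add: q_def)
  have "p + a div 2 + (n - a) div 2 \<le> q + n div 2"
  proof (cases "even n")
    case True
    have "4 * int p \<le> 4 * int q + 4"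
      using p best_part_product(4) [OF n True] zero_le_power2 [of "int n - 2 * int a"]
      unfolding q_def by linarith
    then have le: "p \<le> q + 1"
      by linarith
    show ?thesis
    proof (cases "even a")
      case True
      then have "even p"
        by (simp add: p_def)
      with le \<open>even q\<close> have "p \<le> q"
        by presburger
      then show ?thesis
        using halves_eq [OF a] True by simp
    next
      case False
      then show ?thesis
        using halves_Suc [OF a \<open>even n\<close>] le by simp
    qed
  next
    case False
    then have "(int n - 2 * int a) \<noteq> 0"
      by presburger
    then have "1 \<le> (int n - 2 * int a)\<^sup>2"
      by (simp add: int_one_le_iff_zero_less)
    then have "p \<le> q"
      using p best_part_product(5) [OF n False] unfolding q_def by linarith
    then show ?thesis
      using halves_eq [OF a] False by simp
  qed
  then show ?thesis
    by (simp add: p_def q_def best_size_def)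
qed

text \<open>The term \<open>2 / n\<close> stems from \<open>n mod 4 = 2\<close>, where the integer
  estimate is an equality.\<close>

lemma best_size_lower:
  assumes "4 \<le> n"
  shows "n / 2 + 1 - 2 / n \<le> 2 * real (best_size n) / n"
proof -
  have "int n ^ 2 + 2 * int n - 4 \<le> 4 * int (best_size n)"
  proof (cases "even n")
    case True
    then have "2 * int (n div 2) = int n"
      by presburger
    then show ?thesis
      using best_part_product(4) [OF assms True] by (simp add: best_size_def)
  next
    case False
    then have "2 * int (n div 2) = int n - 1"
      by presburger
    then show ?thesis
      using best_part_product(5) [OF assms False] by (simp add: best_size_def)
  qed
  then have "real_of_int (int n ^ 2 + 2 * int n - 4) \<le> real_of_int (4 * int (best_size n))"
    by (simp only: of_int_le_iff)
  then have "real n ^ 2 + 2 * real n - 4 \<le> 4 * real (best_size n)"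
    by simp
  then have "(real n ^ 2 + 2 * real n - 4) / (2 * n) \<le> 4 * real (best_size n) / (2 * n)"
    by (rule divide_right_mono) simp
  moreover have "(real n ^ 2 + 2 * real n - 4) / (2 * n) = n / 2 + 1 - 2 / n"
    using assms by (simp add: field_simps power2_eq_square)
  ultimately show ?thesis
    by simp
qed

text \<open>For odd \<open>a\<close> the product is odd while the reference product is even, so it
  is strictly larger, which pays for the pair lost to rounding.\<close>

lemma product_ge_imp_size_ge_even:
  assumes n: "4 \<le> n" "even n" and a: "a \<le> n"
    and ge: "best_part n * (n - best_part n) \<le> a * (n - a)"
  shows "best_size n \<le> a * (n - a) + a div 2 + (n - a) div 2"
proof (cases "even a")
  case True
  then show ?thesis
    using halves_eq [OF a] ge by (simp add: best_size_def)
next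
  case False
  have "even (best_part n * (n - best_part n))"
    using best_part_product(3) [OF n(1)] by simp
  moreover have "odd (a * (n - a))"
    using False n a by simp
  ultimately have "best_part n * (n - best_part n) < a * (n - a)"
    using ge by (cases "best_part n * (n - best_part n) = a * (n - a)") auto
  then show ?thesis
    using halves_Suc [OF a n(2) False] by (simp add: best_size_def)
qed

text \<open>For odd \<open>n\<close> one of \<open>a\<close> and \<open>n - a\<close> is even, so
  both products are even and a smaller product is smaller by at least 2. Such a gap is incompatible
  with the average degree of the comparison graph.\<close>

lemma eigenvalue_bound_imp_size_ge_odd:
  assumes n: "4 \<le> n" "odd n" and a: "a \<le> n"
    and ge: "2 * real (best_size n) / n \<le> 1 + sqrt (a * (real n - a))"
  shows "best_size n \<le> a * (n - a) + a div 2 + (n - a) div 2"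
proof -
  define p q where "p = a * (n - a)" and "q = best_part n * (n - best_part n)"
  have q: "4 * int q = (int n)\<^sup>2 - 1"
    unfolding q_def by (rule best_part_product(5) [OF n])
  then have "real_of_int (4 * int q) = real_of_int ((int n)\<^sup>2 - 1)"
    by (simp only:)
  then have q': "4 * real q = (real n)\<^sup>2 - 1"
    by simp
  have half: "2 * real (n div 2) = real n - 1"
  proof -
    have "n = 2 * (n div 2) + 1"
      using n by presburger
    from arg_cong [OF this, of real] show ?thesis
      by simp
  qed
  have "q \<le> p"
  proof (rule ccontr)
    assume "\<not> q \<le> p"
    moreover have "even p" "even q"
      using n a best_part_product(3) [OF n(1)] by (auto simp: p_def q_def)
    ultimately have "p + 2 \<le> q"
      by presburger
    then have pq: "real p \<le> real q - 2"
      by linarith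
    have p: "real p = a * (real n - a)"
      using a by (simp add: p_def of_nat_diff)
    have "2 * real (best_size n) / n = (2 * real q - 1) / n + 1"
      using half n by (simp add: best_size_def q_def [symmetric] field_simps)
    then have "(2 * real q - 1) / n \<le> sqrt p"
      using ge by (simp add: p)
    moreover have "0 \<le> (2 * real q - 1) / n"
      using pq by simp
    ultimately have "((2 * real q - 1) / n)\<^sup>2 \<le> (sqrt p)\<^sup>2"
      by (rule power_mono)
    then have "(2 * real q - 1)\<^sup>2 \<le> real p * (real n)\<^sup>2"
      using n by (simp add: power_divide divide_le_eq)
    also have "\<dots> \<le> (real q - 2) * (real n)\<^sup>2"
      using pq by (intro mult_right_mono) auto
    also have "(real n)\<^sup>2 = 4 * real q + 1"
      using q' by simp
    \<comment> \<open>This expands to \<open>3 q \<le> - 3\<close>; a gap of only 1 between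
      \<open>p\<close> and \<open>q\<close> would give no contradiction.\<close>
    finally have "(2 * real q - 1)\<^sup>2 \<le> (real q - 2) * (4 * real q + 1)" .
    then show False
      by (simp add: power2_eq_square algebra_simps)
  qed
  then show ?thesis
    using halves_eq [OF a] n(2) by (simp add: best_size_def p_def q_def)
qed

theorem theorem2:
  shows "\<exists>N::nat. \<forall>n\<ge>N. SPEX_family n (wheel 5) \<subseteq> EX_family n (wheel 5)"
proof (intro exI [of _ "10 ^ 13"] allI impI subsetI)
  fix n :: nat and G
  assume n: "10 ^ 13 \<le> n" and G: "G \<in> SPEX_family n (wheel 5)"
  have "4 \<le> n"
    using n by simp
  note best = best_part_product(1-3) [OF \<open>4 \<le> n\<close>]
  define B where "B = matched_bipartite n (best_part n)"
  have B: "B \<in> free_graphs n (wheel 5)" "best_size n \<le> card (edges B)"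
    using best matched_bipartite_free(4) card_edges_matched_bipartite
    by (auto simp: B_def best_size_def)
  have average: "2 * real (best_size n) / n \<le> lambda1 H"
    if "H \<in> free_graphs n (wheel 5)" "best_size n \<le> card (edges H)" for H
    using lambda1_ge_average_degree [of H n] that \<open>4 \<le> n\<close>
    by (simp add: free_graphs_wheel5_iff divide_le_eq)
  have Gf: "G \<in> free_graphs n (wheel 5)" and "lambda1 B \<le> lambda1 G"
    using G B(1) finite_free_graphs [of n "wheel 5"] by (auto simp: SPEX_family_def)
  \<comment> \<open>A graph with more edges would have an average degree that forces the
    near-bipartite structure, which in turn caps its edges.\<close>
  have upper: "card (edges H) \<le> best_size n" if H: "H \<in> free_graphs n (wheel 5)" for H
  proof (rule ccontr)
    assume *: "\<not> ?thesis"
    then have "n / 2 + 1 - 2 / n \<le> lambda1 H"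
      using average [OF H] best_size_lower [OF \<open>4 \<le> n\<close>] by simp
    with H n obtain A where A: "A \<subseteq> {..<n}" "card A < n" "inner_matching H A"
      by (rule near_bipartition_of_free_graph)
    interpret bipartitioned_ugraph H A
      using H by unfold_locales (simp add: free_graphs_wheel5_iff)
    have "card (edges H) \<le> card A * (n - card A) + card A div 2 + (n - card A) div 2"
      using card_edges_le A H by (simp add: free_graphs_wheel5_iff)
    also have "\<dots> \<le> best_size n"
      using A \<open>4 \<le> n\<close> by (intro best_size_max) auto
    finally show False
      using * by simp
  qed
  have "n / 2 + 1 - 2 / n \<le> lambda1 G"
    using average [OF B] best_size_lower [OF \<open>4 \<le> n\<close>] \<open>lambda1 B \<le> lambda1 G\<close> by simp
  with Gf n obtain A where A: "A \<subseteq> {..<n}" "0 < card A" "card A < n" "inner_matching G A"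
    by (rule near_bipartition_of_free_graph)
  have G_le: "lambda1 G \<le> 1 + sqrt (card A * (real n - card A))"
    using Gf A by (intro lambda1_le_1_plus_sqrt) (auto simp: free_graphs_wheel5_iff)
  \<comment> \<open>For even \<open>n\<close>, \<open>B\<close> reaches the upper bound belonging to
    its own parts, so products are compared directly; for odd \<open>n\<close> its average degree is
    used instead.\<close>
  have "best_size n \<le> card A * (n - card A) + card A div 2 + (n - card A) div 2"
  proof (cases "even n")
    case True
    have "sqrt (best_part n * (real n - best_part n)) \<le> sqrt (card A * (real n - card A))"
      using lambda1_matched_bipartite [OF best True] \<open>lambda1 B \<le> lambda1 G\<close> G_le
      unfolding B_def by linarith
    then have "real (best_part n * (n - best_part n)) \<le> real (card A * (n - card A))"
      using best A by (simp add: of_nat_diff)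
    then have "best_part n * (n - best_part n) \<le> card A * (n - card A)"
      by (simp only: of_nat_le_iff)
    then show ?thesis
      using A True \<open>4 \<le> n\<close> by (intro product_ge_imp_size_ge_even) auto
  next
    case False
    have "2 * real (best_size n) / n \<le> 1 + sqrt (card A * (real n - card A))"
      using average [OF B] \<open>lambda1 B \<le> lambda1 G\<close> G_le by simp
    then show ?thesis
      using A False \<open>4 \<le> n\<close> by (intro eigenvalue_bound_imp_size_ge_odd) auto
  qed
  also have "\<dots> \<le> card (edges G)"
    using G A by (rule card_edges_SPEX_ge)
  finally have "card (edges G) = best_size n"
    using upper [OF Gf] by simp
  moreover have "ex_number n (wheel 5) = best_size n"
    unfolding ex_number_def
  proof (rule Max_eqI)
    show "finite ((\<lambda>G. card (edges G)) ` free_graphs n (wheel 5))"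
      by (intro finite_imageI finite_free_graphs)
    show "best_size n \<in> (\<lambda>G. card (edges G)) ` free_graphs n (wheel 5)"
      using Gf \<open>card (edges G) = best_size n\<close> by (metis imageI)
  qed (use upper in blast)
  ultimately show "G \<in> EX_family n (wheel 5)"
    using Gf by (simp add: EX_family_def)
qed

end
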